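(* Let $n\ge1$ and let $t>0$ be fixed. Suppose $F$ is a holomorphic function on $\mathbb{C}^n$. Then there exists a function $f\in\mathcal{S}(\mathbb{R}^n)$ such that $F=e^{-tH}f$ if and only if there are constants $A_m$, $m=1,2,3,\dots$, such that for every $m$ and all $z=x+iy\in\mathbb{C}^n$ ($x,y\in\mathbb{R}^n$) $$|F(z)|^2\le A_m\,\frac{e^{-(\tanh 2t)x^2+(\coth 2t)y^2}}{(1+x^2+y^2)^{2m}}.$$
   Context: For $x\in\mathbb{R}^n$, $x^2=x_1^2+\cdots+x_n^2$; for $z\in\mathbb{C}^n$, $z^2=z_1^2+\cdots+z_n^2$ and $z\cdot u=\sum z_ju_j$. $\mathcal{S}(\mathbb{R}^n)$ is the Schwartz space. $e^{-tH}$ is the Hermite semigroup, $e^{-tH}f=\sum_\alpha e^{-(2|\alpha|+n)t}(f,\Phi_\alpha)\Phi_\alpha$, where $\Phi_\alpha$ ($\alpha\in\mathbb{N}^n$) are the $L^2$-normalised Hermite functions on $\mathbb{R}^n$; equivalently $e^{-tH}f(x)=\int_{\mathbb{R}^n}f(u)K_t(x,u)\,du$ with $K_t(x,u)=(2\pi)^{-n/2}(\sinh 2t)^{-n/2}e^{-\frac12\coth(2t)(x^2+u^2)+\frac{1}{\sinh 2t}x\cdot u}$. The function $e^{-tH}f$ extends to an entire function on $\mathbb{C}^n$ (replace $x$ by $z$ in the kernel), and $F=e^{-tH}f$ refers to this extension. *)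

theory Defs
  imports "HOL-Analysis.Analysis"
begin

definition coth :: "real \<Rightarrow> real" where
  "coth s = cosh s / sinh s"

(* Bilinear square z_1^2 + ... + z_n^2, without conjugation; over the complex numbers it is
   not the squared norm, just as scalar_product is not the inner product there. *)
definition vec_sq :: "'a::comm_semiring_1 ^ 'n \<Rightarrow> 'a" where
  "vec_sq z = (\<Sum>j\<in>UNIV. (z $ j)\<^sup>2)"

definition cvec :: "real ^ 'n \<Rightarrow> real ^ 'n \<Rightarrow> complex ^ 'n" where
  "cvec x y = (\<chi> j. Complex (x $ j) (y $ j))"

abbreviation of_real_vec :: "real ^ 'n \<Rightarrow> complex ^ 'n" where
  "of_real_vec u \<equiv> (\<chi> j. complex_of_real (u $ j))"

(* Complex Frechet differentiability at every point: the real derivative has to be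
   complex linear, i.e. of the form h \<mapsto> a_1 h_1 + ... + a_n h_n. *)
definition holomorphic_Cn :: "(complex ^ 'n \<Rightarrow> complex) \<Rightarrow> bool" where
  "holomorphic_Cn F \<longleftrightarrow> (\<forall>z. \<exists>a. (F has_derivative (\<lambda>h. scalar_product a h)) (at z))"

definition partial_deriv :: "'n \<Rightarrow> (real ^ 'n \<Rightarrow> complex) \<Rightarrow> real ^ 'n \<Rightarrow> complex" where
  "partial_deriv j f x = vector_derivative (\<lambda>s. f (x + s *\<^sub>R axis j 1)) (at 0)"

(* Higher derivatives are indexed by the list of directions of differentiation rather than by a
   multi-index; for smooth functions the order is irrelevant, so both describe the same
   family of derivatives. *)
fun iter_partial :: "'n list \<Rightarrow> (real ^ 'n \<Rightarrow> complex) \<Rightarrow> real ^ 'n \<Rightarrow> complex" where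
  "iter_partial [] f = f"
| "iter_partial (j # js) f = partial_deriv j (iter_partial js f)"

(* The differentiability clause is needed because vector_derivative is a total function. *)
definition smooth_Rn :: "(real ^ 'n \<Rightarrow> complex) \<Rightarrow> bool" where
  "smooth_Rn f \<longleftrightarrow>
     (\<forall>js. continuous_on UNIV (iter_partial js f) \<and>
           (\<forall>j x. (\<lambda>s. iter_partial js f (x + s *\<^sub>R axis j 1)) differentiable (at 0)))"

definition schwartz_space :: "(real ^ 'n \<Rightarrow> complex) set" where
  "schwartz_space = {f. smooth_Rn f \<and>
     (\<forall>(\<alpha> :: 'n \<Rightarrow> nat) js. \<exists>C. \<forall>x.
        cmod (complex_of_real (\<Prod>j\<in>UNIV. (x $ j) ^ \<alpha> j) * iter_partial js f x) \<le> C)}"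

(* The kernel of the Hermite semigroup exp(-tH) (Mehler's formula), with the first
   variable extended to complex vectors. *)
definition mehler_kernel :: "real \<Rightarrow> complex ^ 'n \<Rightarrow> real ^ 'n \<Rightarrow> complex" where
  "mehler_kernel t z u =
     complex_of_real ((2 * pi) powr (- real CARD('n) / 2) * sinh (2 * t) powr (- real CARD('n) / 2)) *
     exp (- (1 / 2) * complex_of_real (coth (2 * t)) * (vec_sq z + complex_of_real (vec_sq u))
          + complex_of_real (1 / sinh (2 * t)) * scalar_product z (of_real_vec u))"

(* The entire extension of exp(-tH) f. *)
definition hermite_semigroup :: "real \<Rightarrow> (real ^ 'n \<Rightarrow> complex) \<Rightarrow> complex ^ 'n \<Rightarrow> complex" where
  "hermite_semigroup t f z = (LINT u|lborel. f u * mehler_kernel t z u)"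

end

theory Submission
  imports Defs "HOL-Complex_Analysis.Cauchy_Integral_Formula"
begin

text \<open>Write \<open>c = coth 2t\<close> and \<open>s = 1/sinh 2t\<close>, so that \<open>c\<^sup>2 - s\<^sup>2 = 1\<close> and \<open>tanh 2t = 1/c\<close>. Up to the factor
  \<open>C exp(-c z\<^sup>2/2)\<close>, the semigroup is \<open>Tf(z) = \<integral> f(u) exp(-c u\<^sup>2/2 + s z\<cdot>u) du\<close>. For bounded \<open>f\<close>,
  completing the square gives \<open>|Tf(x+iy)| \<le> C exp(s\<^sup>2x\<^sup>2/(2c))\<close>; integration by parts gives
  \<open>z\<^sub>j Tf = T((c u\<^sub>j f - \<partial>\<^sub>j f)/s)\<close>, which for Schwartz \<open>f\<close> yields the polynomial decay.

  Conversely, \<open>G(z) = F(z) exp(c z\<^sup>2/2)\<close> decays rapidly on every \<open>x + i\<real>\<^sup>n\<close>, and \<open>f\<close> is, up to a constant,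
  \<open>exp(c u\<^sup>2/2) \<integral> G(iy) exp(-is y\<cdot>u) dy\<close>. Shifting the contour to \<open>x = (c/s) u\<close> shows that \<open>f\<close> decays
  rapidly, and its derivatives are combinations of \<open>u\<^sub>j f\<close> and of the functions of the same form that
  belong to \<open>z\<^sub>j G\<close>. Shifting to any other \<open>x\<close> and inverting the Fourier transform in \<open>y\<close> gives
  \<open>Tf(x+iy) = G(x+iy)\<close> without appeal to an identity theorem.\<close>

section \<open>An integrable weight\<close>

text \<open>The exponential rates match exactly, so nothing is lost in either direction. Put
  \<kappa> = s^2/(2c). From c^2 - s^2 = 1 follows 2\<kappa> = c - 1/c, and |exp(-c z^2/2)|^2 =
  exp(-c x^2 + c y^2) turns the growth exp(2\<kappa> x^2) of |Tf|^2 into exp(-x^2/c + c y^2), the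
  stated bound. Read backwards, multiplying F by exp(c z^2/2) removes the Gaussian growth in y and
  leaves growth exp(\<kappa> x^2) in x. In the inverse formula, a shift to real part x bounds the
  integral by a multiple of exp(\<kappa> x^2 - s x.u). The minimum over x is exp(-c u^2/2), attained
  at x = (c/s) u, and it cancels the factor exp(c u^2/2) of f. What remains is the polynomial decay
  of G, which is the Schwartz decay of f. Passages to the limit under integrals need majorants in n
  variables. The integrable function \<open>weight\<close> supplies most of them, so that domination
  becomes an estimate by a constant multiple of it.\<close>

definition weight :: "real ^ 'n \<Rightarrow> real" where
  "weight y = 1 / (1 + (norm y)\<^sup>2) ^ CARD('n)"

lemma weight_pos: "0 < weight y"
  by (simp add: weight_def add_pos_nonneg)

lemma weight_le_1: "weight y \<le> 1"
  by (simp add: weight_def divide_le_eq_1 one_le_power zero_less_power add_pos_nonneg)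

lemma continuous_on_weight: "continuous_on S weight"
  unfolding weight_def
  by (intro continuous_intros) (metis add_pos_nonneg zero_less_one zero_le_power2 power_eq_0_iff less_irrefl)

text \<open>The arctangent settles the half-line from 0, and the reflection x \<mapsto> -x the other
  one. Both half-lines contain 0, so their sum is only an upper bound, which is enough for
  finiteness.\<close>

lemma nn_integral_inverse_1_plus_square_finite:
  "(\<integral>\<^sup>+x. ennreal (1 / (1 + x\<^sup>2)) \<partial>lborel) < \<infinity>"
proof -
  have fin: "(\<integral>\<^sup>+x. ennreal (1 / (1 + x\<^sup>2)) * indicator {0..} x \<partial>lborel) = ennreal (pi / 2 - arctan 0)"
    by (rule nn_integral_FTC_atLeast)
      (auto intro!: derivative_eq_intros tendsto_arctan_at_top simp: field_simps)
  have "(\<integral>\<^sup>+x. ennreal (1 / (1 + x\<^sup>2)) \<partial>lborel) \<le>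
      (\<integral>\<^sup>+x. ennreal (1 / (1 + x\<^sup>2)) * indicator {0..} x +
            ennreal (1 / (1 + (0 + (-1) * x)\<^sup>2)) * indicator {0..} (0 + (-1) * x) \<partial>lborel)"
    by (intro nn_integral_mono) (auto split: split_indicator)
  also have "\<dots> = (\<integral>\<^sup>+x. ennreal (1 / (1 + x\<^sup>2)) * indicator {0..} x \<partial>lborel) +
        (\<integral>\<^sup>+x. ennreal (1 / (1 + (0 + (-1) * x)\<^sup>2)) * indicator {0..} (0 + (-1) * x) \<partial>lborel)"
    by (rule nn_integral_add) auto
  also have "(\<integral>\<^sup>+x. ennreal (1 / (1 + (0 + (-1) * x)\<^sup>2)) * indicator {0..} (0 + (-1) * x) \<partial>lborel)
      = (\<integral>\<^sup>+x. ennreal (1 / (1 + x\<^sup>2)) * indicator {0..} x \<partial>lborel)"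
    using nn_integral_real_affine[of "\<lambda>x. ennreal (1 / (1 + x\<^sup>2)) * indicator {0..} x" "-1" 0] by simp
  finally show ?thesis by (simp add: fin flip: ennreal_plus) (use le_less_trans ennreal_less_top in blast)
qed

text \<open>Every factor \<open>1 + (y \<bullet> b)\<^sup>2\<close> is at most
  \<open>1 + (norm y)\<^sup>2\<close>. The exponent \<open>CARD('n)\<close> thus puts the weight
  below a product of one-dimensional functions, whose integral factorises.\<close>

lemma integrable_weight: "integrable lborel (weight :: real ^ 'n \<Rightarrow> real)"
proof (rule integrableI_bounded)
  show "weight \<in> borel_measurable lborel"
    using borel_measurable_continuous_onI[OF continuous_on_weight[of UNIV]] by simp
  have le: "weight y \<le> (\<Prod>b\<in>Basis. 1 / (1 + (y \<bullet> b)\<^sup>2))" for y :: "real ^ 'n"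
  proof -
    have "(\<Prod>b\<in>(Basis :: (real ^ 'n) set). 1 + (y \<bullet> b)\<^sup>2) \<le> (\<Prod>b\<in>(Basis :: (real ^ 'n) set). 1 + (norm y)\<^sup>2)"
      by (intro prod_mono) (auto intro: power_mono[OF Basis_le_norm, of _ y 2, simplified] simp: abs_le_square_iff[symmetric] Basis_le_norm)
    also have "\<dots> = (1 + (norm y)\<^sup>2) ^ CARD('n)"
      by simp
    finally have "(\<Prod>b\<in>(Basis :: (real ^ 'n) set). 1 + (y \<bullet> b)\<^sup>2) \<le> (1 + (norm y)\<^sup>2) ^ CARD('n)" .
    moreover have "0 < (\<Prod>b\<in>(Basis :: (real ^ 'n) set). 1 + (y \<bullet> b)\<^sup>2)"
      by (intro prod_pos) (auto simp: add_pos_nonneg)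
    ultimately show ?thesis
      by (simp add: weight_def prod_dividef frac_le)
  qed
  have "(\<integral>\<^sup>+x. ennreal (norm (weight (x :: real ^ 'n))) \<partial>lborel) \<le>
      (\<integral>\<^sup>+x. (\<Prod>b\<in>Basis. ennreal (1 / (1 + ((x :: real ^ 'n) \<bullet> b)\<^sup>2))) \<partial>lborel)"
    using le by (intro nn_integral_mono) (simp add: prod_ennreal weight_pos less_imp_le ennreal_leI)
  also have "\<dots> = (\<Prod>b\<in>(Basis :: (real ^ 'n) set). (\<integral>\<^sup>+x. ennreal (1 / (1 + x\<^sup>2)) \<partial>lborel))"
    by (rule nn_integral_lborel_prod) auto
  also have "\<dots> < \<infinity>"
    using nn_integral_inverse_1_plus_square_finite by (simp add: power_less_top_ennreal)
  finally show "(\<integral>\<^sup>+x. ennreal (norm (weight (x :: real ^ 'n))) \<partial>lborel) < \<infinity>" .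
qed

lemma borel_measurable_continuous_UNIV:
  fixes h :: "'a::euclidean_space \<Rightarrow> 'b::topological_space"
  shows "continuous_on UNIV h \<Longrightarrow> h \<in> borel_measurable lborel"
  using borel_measurable_continuous_onI by simp

lemma integrable_weight_bound:
  fixes h :: "real ^ 'n \<Rightarrow> 'b::{banach, second_countable_topology}"
  assumes "h \<in> borel_measurable lborel" "\<And>y. norm (h y) \<le> M * weight y"
  shows "integrable lborel h"
proof (rule Bochner_Integration.integrable_bound)
  show "integrable lborel (\<lambda>y. M * weight (y :: real ^ 'n))"
    by (intro integrable_mult_right integrable_weight)
  show "AE y in lborel. norm (h y) \<le> norm (M * weight y)"
    using order_trans[OF assms(2) abs_ge_self] by (intro AE_I2) simp
qed (use assms in auto)

lemma integral_weight_bound: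
  fixes h :: "real ^ 'n \<Rightarrow> 'b::{banach, second_countable_topology}"
  assumes "h \<in> borel_measurable lborel" "\<And>y. norm (h y) \<le> M * weight y"
  shows "norm (LINT y|lborel. h y) \<le> M * (LINT y|lborel. weight (y :: real ^ 'n))"
  using Bochner_Integration.integral_norm_bound_integral[OF integrable_weight_bound[OF assms] integrable_mult_right[OF integrable_weight] assms(2)]
  by simp

text \<open>An inequality of Peetre type: shifting the argument by a bounded vector costs only a
  constant, so a shifted integrand keeps the same majorant up to that constant.\<close>

lemma weight_translate_le: "weight y \<le> (2 * (1 + (norm a)\<^sup>2)) ^ CARD('n) * weight (y + a :: real ^ 'n)"
proof -
  have n: "norm (y + a) \<le> norm y + norm a" by (rule norm_triangle_ineq)
  have "(norm (y + a))\<^sup>2 \<le> (norm y + norm a)\<^sup>2" by (rule power_mono[OF n]) simp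
  also have "\<dots> \<le> 2 * (norm y)\<^sup>2 + 2 * (norm a)\<^sup>2"
    using sum_squares_ge_zero[of "norm y - norm a" 0] by (simp add: power2_eq_square algebra_simps)
  finally have "1 + (norm (y + a))\<^sup>2 \<le> 1 + 2 * (norm y)\<^sup>2 + 2 * (norm a)\<^sup>2" by simp
  also have "\<dots> \<le> 2 * (1 + (norm a)\<^sup>2) * (1 + (norm y)\<^sup>2)"
    by (simp add: algebra_simps)
  finally have "(1 + (norm (y + a))\<^sup>2) ^ CARD('n) \<le> (2 * (1 + (norm a)\<^sup>2) * (1 + (norm y)\<^sup>2)) ^ CARD('n)"
    by (intro power_mono) auto
  then show ?thesis
    by (simp add: weight_def power_mult_distrib divide_simps add_pos_nonneg less_imp_neq[THEN not_sym] mult.commute)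
qed

lemma exp_neg_poly_bounded:
  assumes "0 < (a::real)"
  obtains C where "0 \<le> C" "\<And>r. 0 \<le> r \<Longrightarrow> exp (- a * r) \<le> C / (1 + r) ^ N"
proof -
  \<comment> \<open>The single term of order N in the series of exp(a (1 + r)) already bounds (1 +
    r)^N; the factor \<open>exp a\<close> pays for replacing r by 1 + r.\<close>
  define C where "C = fact N * exp a / a ^ N"
  have "exp (- a * r) \<le> C / (1 + r) ^ N" if "0 \<le> r" for r
  proof -
    have "(a * (1 + r)) ^ N / fact N \<le> (\<Sum>k\<le>N. (a * (1 + r)) ^ k / fact k)"
      using assms that by (intro member_le_sum) auto
    also have "\<dots> \<le> exp (a * (1 + r))"
      using assms that unfolding exp_def
      by (auto simp: divide_inverse mult.commute intro!: sum_le_suminf summable_exp)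
    finally have "(a * (1 + r)) ^ N / fact N \<le> exp a * exp (a * r)"
      by (simp add: distrib_left exp_add)
    then have "a ^ N * (1 + r) ^ N \<le> fact N * (exp a * exp (a * r))"
      by (simp add: divide_le_eq mult.commute power_mult_distrib)
    then show ?thesis
      using assms that by (simp add: C_def exp_minus field_simps)
  qed
  moreover have "0 \<le> C" using assms by (simp add: C_def)
  ultimately show ?thesis using that by blast
qed

lemma integral_affine_UNIV:
  fixes f :: "'a::euclidean_space \<Rightarrow> 'b::{banach, second_countable_topology}"
  assumes "f \<in> borel_measurable lborel" "c \<noteq> 0"
  shows "(LINT x|lborel. f x) = \<bar>c\<bar> ^ DIM('a) *\<^sub>R (LINT x|lborel. f (t + c *\<^sub>R x))"
  using assms
  by (subst lborel_affine[OF assms(2), of t])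
    (simp add: integral_density integral_distr)

lemma integral_translate:
  fixes f :: "'a::euclidean_space \<Rightarrow> 'b::{banach, second_countable_topology}"
  assumes "f \<in> borel_measurable lborel"
  shows "(LINT x|lborel. f (x + t)) = (LINT x|lborel. f x)"
  using integral_affine_UNIV[OF assms, of 1 t] by (simp add: add.commute)

section \<open>Entire functions on complex space\<close>

lemma vec_sq_real: "vec_sq (x :: real ^ 'n) = (norm x)\<^sup>2"
  by (simp add: vec_sq_def norm_vec_def L2_set_def sum_nonneg)

lemma cvec_nth [simp]: "cvec x y $ j = Complex (x $ j) (y $ j)"
  by (simp add: cvec_def)

lemma cvec_Re_Im: "z = cvec (\<chi> j. Re (z $ j)) (\<chi> j. Im (z $ j))"
  by (simp add: vec_eq_iff)

lemma vec_sq_cvec: "vec_sq (cvec x y) = Complex ((norm x)\<^sup>2 - (norm y)\<^sup>2) (2 * (x \<bullet> y))"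
  unfolding vec_sq_real[symmetric]
  by (simp add: complex_eq_iff vec_sq_def inner_vec_def sum_distrib_left
      power2_eq_square sum_subtractf mult.assoc mult.left_commute)

lemma scalar_product_cvec: "scalar_product (cvec x y) (of_real_vec u) = Complex (x \<bullet> u) (y \<bullet> u)"
  by (simp add: complex_eq_iff scalar_product_def inner_vec_def)

lemma cvec_conv_complex:
  "cvec x y = (\<chi> j. complex_of_real (x $ j) + \<i> * complex_of_real (y $ j))"
  by (simp add: vec_eq_iff complex_eq_iff)

lemma continuous_on_cvec [continuous_intros]:
  assumes "continuous_on S f" "continuous_on S g"
  shows "continuous_on S (\<lambda>p. cvec (f p) (g p))"
  unfolding cvec_conv_complex using assms
  by (intro continuous_on_vec_lambda continuous_intros)

lemma continuous_holomorphic_Cn: "holomorphic_Cn P \<Longrightarrow> continuous_on S P"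
  unfolding holomorphic_Cn_def
  by (meson continuous_at_imp_continuous_on has_derivative_continuous)

lemma continuous_on_holomorphic_Cn [continuous_intros]:
  assumes "holomorphic_Cn P" "continuous_on S f"
  shows "continuous_on S (\<lambda>p. P (f p))"
  using continuous_on_compose2[OF continuous_holomorphic_Cn[OF assms(1), of UNIV] assms(2)] by auto

lemma holomorphic_Cn_mult:
  assumes "holomorphic_Cn P" "holomorphic_Cn Q"
  shows "holomorphic_Cn (\<lambda>z. P z * Q z)"
  unfolding holomorphic_Cn_def
proof
  fix z
  obtain a b where "(P has_derivative scalar_product a) (at z)" "(Q has_derivative scalar_product b) (at z)"
    using assms unfolding holomorphic_Cn_def by blast
  from has_derivative_mult[OF this]
  have "((\<lambda>z. P z * Q z) has_derivative scalar_product (\<chi> j. P z * b $ j + Q z * a $ j)) (at z)"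
    by (rule has_derivative_eq_rhs)
      (simp add: fun_eq_iff scalar_product_def sum_distrib_left sum_distrib_right sum.distrib algebra_simps)
  then show "\<exists>a. ((\<lambda>z. P z * Q z) has_derivative scalar_product a) (at z)" by blast
qed

lemma holomorphic_Cn_exp:
  assumes "holomorphic_Cn P"
  shows "holomorphic_Cn (\<lambda>z. exp (P z))"
  unfolding holomorphic_Cn_def
proof
  fix z
  obtain a where a: "(P has_derivative scalar_product a) (at z)"
    using assms unfolding holomorphic_Cn_def by blast
  have "(exp has_derivative (\<lambda>h. exp (P z) * h)) (at (P z))"
    using DERIV_exp[of "P z"] by (simp add: has_field_derivative_def)
  from has_derivative_compose[OF a this]
  have "((\<lambda>z. exp (P z)) has_derivative scalar_product (\<chi> j. exp (P z) * a $ j)) (at z)"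
    by (rule has_derivative_eq_rhs)
      (simp add: fun_eq_iff scalar_product_def sum_distrib_left algebra_simps)
  then show "\<exists>a. ((\<lambda>z. exp (P z)) has_derivative scalar_product a) (at z)" by blast
qed

lemma has_derivative_vec_nth: "((\<lambda>z. z $ j) has_derivative (\<lambda>h. h $ j)) (at z)"
  by (intro bounded_linear_imp_has_derivative bounded_linear_vec_nth)

lemma holomorphic_Cn_nth: "holomorphic_Cn (\<lambda>z. z $ j)"
  unfolding holomorphic_Cn_def
proof
  fix z :: "complex ^ 'a"
  have "scalar_product (axis j 1) = (\<lambda>h :: complex ^ 'a. h $ j)"
    by (simp add: scalar_product_def axis_def if_distrib[of "\<lambda>x. x * _"] fun_eq_iff cong: if_cong)
  then show "\<exists>a. ((\<lambda>z. z $ j) has_derivative scalar_product a) (at z)"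
    using has_derivative_vec_nth[of j z] by metis
qed

lemma holomorphic_Cn_scalar_product:
  "holomorphic_Cn (\<lambda>z. k * scalar_product z b)"
  unfolding holomorphic_Cn_def
proof
  fix z :: "complex ^ 'a"
  have "((\<lambda>z. k * scalar_product z b) has_derivative (\<lambda>h. k * scalar_product h b)) (at z)"
    unfolding scalar_product_def by (auto intro!: derivative_eq_intros has_derivative_vec_nth)
  moreover have "(\<lambda>h. k * scalar_product h b) = scalar_product (\<chi> j. k * b $ j)"
    by (auto simp: scalar_product_def sum_distrib_left algebra_simps fun_eq_iff)
  ultimately show "\<exists>a. ((\<lambda>z. k * scalar_product z b) has_derivative scalar_product a) (at z)"
    by auto
qed

lemma holomorphic_Cn_vec_sq:
  "holomorphic_Cn (\<lambda>z. k * vec_sq z)"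
  unfolding holomorphic_Cn_def
proof
  fix z :: "complex ^ 'a"
  have "((\<lambda>z. k * vec_sq z) has_derivative (\<lambda>h. k * (\<Sum>j\<in>UNIV. 2 * z $ j * h $ j))) (at z)"
    unfolding vec_sq_def power2_eq_square
    by (auto intro!: derivative_eq_intros has_derivative_vec_nth simp: algebra_simps)
  moreover have "(\<lambda>h. k * (\<Sum>j\<in>UNIV. 2 * z $ j * h $ j)) = scalar_product (\<chi> j. 2 * k * z $ j)"
    by (auto simp: scalar_product_def sum_distrib_left algebra_simps fun_eq_iff)
  ultimately show "\<exists>a. ((\<lambda>z. k * vec_sq z) has_derivative scalar_product a) (at z)"
    by auto
qed

text \<open>Because the direction v is real, \<open>Re w\<close> moves only the real part and
  \<open>Im w\<close> only the imaginary part. Shifts in both parts thereby become values of one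
  function of a single complex variable.\<close>

lemma holomorphic_Cn_line:
  assumes "holomorphic_Cn P"
  shows "(\<lambda>w. P (cvec (x + Re w *\<^sub>R v) (y + Im w *\<^sub>R v))) holomorphic_on UNIV"
  unfolding holomorphic_on_def
proof
  fix w :: complex
  let ?L = "\<lambda>w. cvec (x + Re w *\<^sub>R v) (y + Im w *\<^sub>R v)"
  have L: "?L = (\<lambda>w. cvec x y + (\<chi> j. w * complex_of_real (v $ j)))"
    by (auto simp: vec_eq_iff complex_eq_iff fun_eq_iff)
  have bl: "bounded_linear (\<lambda>w. \<chi> j. w * complex_of_real (v $ j))"
    unfolding linear_conv_bounded_linear[symmetric]
    by (rule linearI) (simp_all add: vec_eq_iff algebra_simps)
  have d: "(?L has_derivative (\<lambda>h. \<chi> j. h * complex_of_real (v $ j))) (at w)"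
    unfolding L using has_derivative_add[OF has_derivative_const bounded_linear_imp_has_derivative[OF bl]]
    by simp
  obtain a where "(P has_derivative scalar_product a) (at (?L w))"
    using assms unfolding holomorphic_Cn_def by blast
  from has_derivative_compose[OF d this]
  have "((\<lambda>w. P (?L w)) has_derivative (*) (scalar_product a (of_real_vec v))) (at w)"
    by (rule has_derivative_eq_rhs) (simp add: scalar_product_def fun_eq_iff sum_distrib_left sum_distrib_right algebra_simps)
  then show "(\<lambda>w. P (?L w)) field_differentiable at w within UNIV"
    unfolding field_differentiable_def has_field_derivative_def by auto
qed

section \<open>Second-order estimates and differentiation under the integral\<close>

lemma holomorphic_second_order_bound:
  assumes hol: "\<phi> holomorphic_on UNIV" and B: "\<And>w. cmod w \<le> 2 \<Longrightarrow> cmod (\<phi> w) \<le> B"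
    and w: "cmod w \<le> 1"
  shows "cmod (\<phi> w - \<phi> 0 - w * deriv \<phi> 0) \<le> 2 * B * (cmod w)\<^sup>2"
proof -
  have der: "((deriv ^^ i) \<phi> has_field_derivative (deriv ^^ Suc i) \<phi> x) (at x)" for i x
    using holomorphic_higher_deriv[OF hol open_UNIV, of i] by (simp add: holomorphic_derivI)
  have "cmod (deriv (deriv \<phi>) x) \<le> 2 * B" if "x \<in> cball 0 1" for x
  proof -
    \<comment> \<open>Unit circles about points of the closed unit disc stay in the disc of radius
      2, where B bounds \<phi>. The factor 2 of the conclusion is this \<open>fact 2\<close>; the
      Taylor remainder below divides only by \<open>fact 1\<close>.\<close>
    have "cmod ((deriv ^^ 2) \<phi> x) \<le> fact 2 * B / 1 ^ 2"
    proof (rule Cauchy_inequality)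
      show "\<phi> holomorphic_on ball x 1" "continuous_on (cball x 1) \<phi>"
        using hol holomorphic_on_subset holomorphic_on_imp_continuous_on by blast+
      fix w assume "cmod (x - w) = 1"
      then have "cmod w \<le> 2"
        using norm_triangle_ineq4[of x "x - w"] that by simp
      then show "cmod (\<phi> w) \<le> B" by (rule B)
    qed simp
    then show ?thesis by (simp add: numeral_2_eq_2)
  qed
  then have "cmod ((deriv ^^ 0) \<phi> w - (\<Sum>i\<le>1. (deriv ^^ i) \<phi> 0 * (w - 0) ^ i / fact i))
     \<le> 2 * B * cmod (w - 0) ^ Suc 1 / fact 1"
    using w by (intro complex_Taylor[where S = "cball 0 1"])
      (auto intro: DERIV_subset[OF der[simplified]])
  then show ?thesis by (simp add: numeral_2_eq_2 algebra_simps)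
qed

text \<open>The left-hand side is chosen so that the first-order terms at \<open>\<epsilon>\<close> and \<open>\<i>\<epsilon>\<close> cancel.\<close>

lemma holomorphic_square_difference:
  assumes hol: "\<phi> holomorphic_on UNIV" and B: "\<And>w. cmod w \<le> 2 \<Longrightarrow> cmod (\<phi> w) \<le> B"
    and e: "\<bar>e\<bar> \<le> (1::real)"
  shows "cmod (\<phi> (of_real e) - \<phi> 0 + \<i> * (\<phi> (\<i> * of_real e) - \<phi> 0)) \<le> 4 * B * e\<^sup>2"
proof -
  let ?r = "\<lambda>w. \<phi> w - \<phi> 0 - w * deriv \<phi> 0"
  have "\<phi> (of_real e) - \<phi> 0 + \<i> * (\<phi> (\<i> * of_real e) - \<phi> 0) = ?r (of_real e) + \<i> * ?r (\<i> * of_real e)"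
    by (simp add: algebra_simps)
  also have "cmod \<dots> \<le> cmod (?r (of_real e)) + cmod (?r (\<i> * of_real e))"
    using norm_triangle_ineq[of "?r (of_real e)" "\<i> * ?r (\<i> * of_real e)"] by (simp add: norm_mult)
  also have "\<dots> \<le> 2 * B * e\<^sup>2 + 2 * B * e\<^sup>2"
    using holomorphic_second_order_bound[OF hol B, of "of_real e"]
      holomorphic_second_order_bound[OF hol B, of "\<i> * of_real e"] e
    by (intro add_mono) (simp_all add: norm_mult)
  finally show ?thesis by simp
qed

text \<open>A quadratic error bound survives integration against an integrable majorant. An integral
  can therefore be differentiated in a parameter from a pointwise second-order estimate, without a
  separate exchange of limits.\<close>

lemma has_vector_derivative_of_quadratic:
  fixes g :: "real \<Rightarrow> 'a::real_normed_vector"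
  assumes "\<And>e. \<bar>e\<bar> \<le> 1 \<Longrightarrow> norm (g (t + e) - g t - e *\<^sub>R D) \<le> C * e\<^sup>2"
  shows "(g has_vector_derivative D) (at t)"
  unfolding has_vector_derivative_def has_derivative_at
proof (intro conjI bounded_linear_scaleR_left)
  show "((\<lambda>e. norm (g (t + e) - g t - e *\<^sub>R D) / norm e) \<longlongrightarrow> 0) (at 0)"
  proof (rule Lim_null_comparison)
    show "((\<lambda>e. C * \<bar>e\<bar>) \<longlongrightarrow> 0) (at (0::real))"
      by (auto intro!: tendsto_eq_intros)
    have "norm (norm (g (t + e) - g t - e *\<^sub>R D) / norm e) \<le> C * \<bar>e\<bar>" if "e \<noteq> 0" "\<bar>e\<bar> < 1" for e
      using assms[of e] that by (simp add: divide_le_eq power2_eq_square)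
    then show "\<forall>\<^sub>F e in at 0. norm (norm (g (t + e) - g t - e *\<^sub>R D) / norm e) \<le> C * \<bar>e\<bar>"
      by (auto simp: eventually_at dist_real_def intro!: exI[of _ 1])
  qed
qed

section \<open>Contour shift and Fourier inversion\<close>

text \<open>Translation invariance makes the integral constant in the imaginary direction, so by complex
  differentiability it is constant in the real direction as well.\<close>

lemma integral_cvec_shift:
  fixes P :: "complex ^ 'n \<Rightarrow> complex"
  assumes hol: "holomorphic_Cn P"
    and bound: "\<And>R. \<exists>M. \<forall>x y. norm x \<le> R \<longrightarrow> cmod (P (cvec x y)) \<le> M * weight y"
  shows "(LINT y|lborel. P (cvec x y)) = (LINT y|lborel. P (cvec 0 y))"
proof -
  define \<Psi> where "\<Psi> = (\<lambda>\<tau>. LINT y|lborel. P (cvec (\<tau> *\<^sub>R x) y))"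
  have meas: "(\<lambda>y. P (cvec (f y) (g y))) \<in> borel_measurable lborel"
    if "continuous_on UNIV f" "continuous_on UNIV g" for f g :: "real ^ 'n \<Rightarrow> real ^ 'n"
    by (intro borel_measurable_continuous_UNIV continuous_on_holomorphic_Cn continuous_on_cvec hol that)
  have deriv: "(\<Psi> has_vector_derivative 0) (at \<tau>)" for \<tau>
  proof -
    obtain M where M: "\<And>x' y. norm x' \<le> (\<bar>\<tau>\<bar> + 2) * norm x \<Longrightarrow> cmod (P (cvec x' y)) \<le> M * weight y"
      using bound by blast
    have "0 \<le> M * weight (0 :: real ^ 'n)"
      using order_trans[OF norm_ge_zero M[of 0 0]] by simp
    then have M0: "0 \<le> M"
      using weight_pos[of "0 :: real ^ 'n"] by (simp add: zero_le_mult_iff not_le)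
    \<comment> \<open>For w in the disc of radius 2 the imaginary part moves by at most 2
      \<open>norm x\<close>. The extra factor is the price of that translation in the weight,
      uniform in w.\<close>
    define M' where "M' = M * (2 * (1 + (2 * norm x)\<^sup>2)) ^ CARD('n)"
    define \<phi> where "\<phi> = (\<lambda>y w. P (cvec (\<tau> *\<^sub>R x + Re w *\<^sub>R x) (y + Im w *\<^sub>R x)))"
    have \<phi>_hol: "\<phi> y holomorphic_on UNIV" for y
      unfolding \<phi>_def by (rule holomorphic_Cn_line[OF hol])
    have \<phi>_bound: "cmod (\<phi> y w) \<le> M' * weight y" if w: "cmod w \<le> 2" for y w
    proof -
      have Re: "\<bar>Re w\<bar> \<le> 2" and Im: "\<bar>Im w\<bar> \<le> 2"
        using w abs_Re_le_cmod[of w] abs_Im_le_cmod[of w] by linarith+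
      have "norm (\<tau> *\<^sub>R x + Re w *\<^sub>R x) \<le> (\<bar>\<tau>\<bar> + 2) * norm x"
        using Re by (auto simp flip: scaleR_add_left intro!: mult_right_mono)
      then have "cmod (\<phi> y w) \<le> M * weight (y + Im w *\<^sub>R x)"
        unfolding \<phi>_def by (rule M)
      also have "weight (y + Im w *\<^sub>R x) \<le> (2 * (1 + (norm (Im w *\<^sub>R x))\<^sup>2)) ^ CARD('n) * weight y"
        using weight_translate_le[of "y + Im w *\<^sub>R x" "- (Im w *\<^sub>R x)"] by simp
      also have "\<dots> \<le> (2 * (1 + (2 * norm x)\<^sup>2)) ^ CARD('n) * weight y"
      proof -
        have "(norm (Im w *\<^sub>R x))\<^sup>2 \<le> (2 * norm x)\<^sup>2"
          using Im by (intro power_mono) (auto intro!: mult_right_mono)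
        then show ?thesis
          by (intro mult_right_mono power_mono) (auto simp: weight_pos less_imp_le)
      qed
      finally show ?thesis using M0 by (simp add: M'_def mult_left_mono mult.assoc)
    qed
    have int: "integrable lborel (\<lambda>y. \<phi> y w)" if "cmod w \<le> 2" for w
      using \<phi>_bound[OF that] unfolding \<phi>_def
      by (intro integrable_weight_bound[where M = M'] meas continuous_intros) auto
    show ?thesis
    proof (rule has_vector_derivative_of_quadratic)
      fix e :: real assume e: "\<bar>e\<bar> \<le> 1"
      have tr: "(LINT y|lborel. \<phi> y (\<i> * of_real e)) = (LINT y|lborel. \<phi> y 0)"
        unfolding \<phi>_def using integral_translate[OF meas[of "\<lambda>_. \<tau> *\<^sub>R x" "\<lambda>y. y"], of "e *\<^sub>R x"]
        by (simp add: continuous_on_const continuous_on_id)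
      \<comment> \<open>The term multiplied by \<i> is zero by \<open>tr\<close>. Adding it removes
        the first-order part of the integrand pointwise, which leaves an error of order e^2.\<close>
      have "\<Psi> (\<tau> + e) - \<Psi> \<tau> - e *\<^sub>R 0 = (LINT y|lborel. \<phi> y (of_real e)) - (LINT y|lborel. \<phi> y 0)
            + \<i> * ((LINT y|lborel. \<phi> y (\<i> * of_real e)) - (LINT y|lborel. \<phi> y 0))"
        unfolding tr by (simp add: \<Psi>_def \<phi>_def scaleR_add_left)
      also have "\<dots> = (LINT y|lborel. \<phi> y (of_real e) - \<phi> y 0 + \<i> * (\<phi> y (\<i> * of_real e) - \<phi> y 0))"
        using e by (subst Bochner_Integration.integral_add integral_mult_right integral_diff;
           (intro Bochner_Integration.integrable_diff integrable_mult_right int)?; simp add: norm_mult int)+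
      also have "norm \<dots> \<le> 4 * M' * e\<^sup>2 * (LINT y|lborel. weight (y :: real ^ 'n))"
      proof (rule integral_weight_bound)
        show "(\<lambda>y. \<phi> y (of_real e) - \<phi> y 0 + \<i> * (\<phi> y (\<i> * of_real e) - \<phi> y 0)) \<in> borel_measurable lborel"
          unfolding \<phi>_def by (intro borel_measurable_continuous_UNIV continuous_intros hol)
        fix y
        show "cmod (\<phi> y (of_real e) - \<phi> y 0 + \<i> * (\<phi> y (\<i> * of_real e) - \<phi> y 0)) \<le> 4 * M' * e\<^sup>2 * weight y"
          using holomorphic_square_difference[OF \<phi>_hol \<phi>_bound e, of y] by (simp add: mult_ac)
      qed
      finally show "norm (\<Psi> (\<tau> + e) - \<Psi> \<tau> - e *\<^sub>R 0) \<le> (4 * M' * (LINT y|lborel. weight (y :: real ^ 'n))) * e\<^sup>2"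
        by (simp add: mult_ac)
    qed
  qed
  have "\<exists>c. \<forall>\<tau>\<in>UNIV. \<Psi> \<tau> = c"
    using deriv by (intro has_derivative_zero_constant) (simp_all add: has_vector_derivative_def)
  then have "\<Psi> 1 = \<Psi> 0" by auto
  then show ?thesis by (simp add: \<Psi>_def)
qed

section \<open>Gaussian integrals and Fourier inversion\<close>

lemma gaussian_weight_bound:
  assumes "0 < a"
  obtains C where "0 \<le> C" "\<And>y :: real ^ 'n. exp (- a * (norm y)\<^sup>2) \<le> C * weight y"
proof -
  obtain C where "0 \<le> C" and C: "\<And>r. 0 \<le> r \<Longrightarrow> exp (- a * r) \<le> C / (1 + r) ^ CARD('n)"
    using exp_neg_poly_bounded[OF assms] by blast
  have "exp (- a * (norm y)\<^sup>2) \<le> C * weight y" for y :: "real ^ 'n"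
    using C[of "(norm y)\<^sup>2"] by (simp add: weight_def)
  with \<open>0 \<le> C\<close> show ?thesis using that by blast
qed

lemma continuous_on_cis [continuous_intros]:
  "continuous_on S f \<Longrightarrow> continuous_on S (\<lambda>x. cis (f x))"
  unfolding cis_conv_exp by (intro continuous_intros)

text \<open>The contour shift for exp(z^2/2): on real part v this function is exp(|v|^2/2) times a
  Gaussian in y times the phase \<open>cis (v \<bullet> y)\<close>, and on real part 0 it is the
  bare Gaussian. The total Gaussian integral stays as an unevaluated constant.\<close>

lemma fourier_gaussian:
  "(LINT u|lborel. complex_of_real (exp (- (norm (u :: real ^ 'n))\<^sup>2 / 2)) * cis (v \<bullet> u)) =
     of_real (exp (- (norm v)\<^sup>2 / 2) * (LINT u|lborel. exp (- (norm (u :: real ^ 'n))\<^sup>2 / 2)))"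
proof -
  define P where "P = (\<lambda>z :: complex ^ 'n. exp (1 / 2 * vec_sq z))"
  have P: "P (cvec x y) = of_real (exp ((norm x)\<^sup>2 / 2)) * (of_real (exp (- (norm y)\<^sup>2 / 2)) * cis (x \<bullet> y))" for x y
  proof -
    have "1 / 2 * vec_sq (cvec x y) =
        of_real ((norm x)\<^sup>2 / 2) + (of_real (- (norm y)\<^sup>2 / 2) + \<i> * of_real (x \<bullet> y))"
      by (simp add: vec_sq_cvec complex_eq_iff)
    then show ?thesis
      by (simp only: P_def exp_add cis_conv_exp of_real_exp)
  qed
  obtain C where C: "0 \<le> C" "\<And>y :: real ^ 'n. exp (- (1 / 2) * (norm y)\<^sup>2) \<le> C * weight y"
    using gaussian_weight_bound[of "1 / 2"] by auto
  have "(LINT y|lborel. P (cvec v y)) = (LINT y|lborel. P (cvec 0 y))"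
  proof (rule integral_cvec_shift)
    show "holomorphic_Cn P"
      unfolding P_def by (intro holomorphic_Cn_exp holomorphic_Cn_vec_sq)
    fix R
    have "cmod (P (cvec x y)) \<le> (exp (R\<^sup>2 / 2) * C) * weight y" if "norm x \<le> R" for x y
    proof -
      have "cmod (P (cvec x y)) = exp ((norm x)\<^sup>2 / 2) * exp (- (1 / 2) * (norm y)\<^sup>2)"
        by (simp add: P norm_mult)
      also have "\<dots> \<le> exp (R\<^sup>2 / 2) * (C * weight y)"
        using that C by (intro mult_mono) (auto intro: power_mono)
      finally show ?thesis by (simp add: mult.assoc)
    qed
    then show "\<exists>M. \<forall>x y. norm x \<le> R \<longrightarrow> cmod (P (cvec x y)) \<le> M * weight y" by blast
  qed
  then have "exp ((norm v)\<^sup>2 / 2) * (LINT u|lborel. complex_of_real (exp (- (norm (u :: real ^ 'n))\<^sup>2 / 2)) * cis (v \<bullet> u))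
      = complex_of_real (LINT u|lborel. exp (- (norm (u :: real ^ 'n))\<^sup>2 / 2))"
    by (simp add: P del: of_real_exp)
  then show ?thesis
    by (simp add: exp_minus field_simps)
qed

text \<open>The damping factor makes the double integral absolutely convergent, so Fubini applies.
  After rescaling, e occurs only in the argument of h, while the kernel \<gamma> is independent of
  e; the right-hand side is an average of h near y as e tends to 0.\<close>

lemma fourier_inversion_aux:
  fixes h :: "real ^ 'n \<Rightarrow> complex" and s e :: real
  assumes h: "continuous_on UNIV h" "\<And>\<eta>. cmod (h \<eta>) \<le> M * weight \<eta>" and e: "0 < e"
  defines "g \<equiv> \<lambda>u. LINT \<eta>|lborel. h \<eta> * cis (- (s * (\<eta> \<bullet> u)))"
  defines "\<gamma> \<equiv> \<lambda>v :: real ^ 'n. LINT u|lborel. complex_of_real (exp (- (norm u)\<^sup>2 / 2)) * cis (s * (v \<bullet> u))"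
  shows "(LINT u|lborel. g u * (cis (s * (y \<bullet> u)) * of_real (exp (- (norm (e *\<^sub>R u))\<^sup>2 / 2)))) =
    (LINT v|lborel. h (y - e *\<^sub>R v) * \<gamma> v)"
proof -
  define E where "E = (\<lambda>u :: real ^ 'n. exp (- (norm (e *\<^sub>R u))\<^sup>2 / 2))"
  define A where "A = (\<lambda>v. LINT u|lborel. of_real (E u) * cis (s * (v \<bullet> u)))"
  define f where "f = (\<lambda>\<eta> u. h \<eta> * (of_real (E u) * cis (s * ((y - \<eta>) \<bullet> u))))"
  have contE: "continuous_on S E" for S
    unfolding E_def by (intro continuous_intros) auto
  have conth: "continuous_on S (\<lambda>p. h (k p))" if "continuous_on S k" for S and k :: "'x::topological_space \<Rightarrow> real ^ 'n"
    using continuous_on_compose2[OF h(1) that] by auto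
  have contE': "continuous_on S (\<lambda>p. E (k p))" if "continuous_on S k" for S and k :: "'x::topological_space \<Rightarrow> real ^ 'n"
    using continuous_on_compose2[OF contE that] by auto
  have contf: "continuous_on UNIV (case_prod f)"
    unfolding f_def case_prod_beta by (intro continuous_intros conth contE')
  obtain C where C: "0 \<le> C" "\<And>u :: real ^ 'n. exp (- (e\<^sup>2 / 2) * (norm u)\<^sup>2) \<le> C * weight u"
    using gaussian_weight_bound[of "e\<^sup>2 / 2"] e by auto
  have E_le: "\<bar>E u\<bar> \<le> C * weight u" for u
    using C(2)[of u] by (simp add: E_def power_mult_distrib)
  have intE: "integrable lborel E"
    using E_le by (intro integrable_weight_bound[where M = C] borel_measurable_continuous_UNIV contE) auto
  have inth: "integrable lborel (\<lambda>\<eta>. cmod (h \<eta>))"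
    using h by (intro integrable_weight_bound[where M = M] borel_measurable_continuous_UNIV continuous_intros) auto
  have nf: "cmod (f \<eta> u) = cmod (h \<eta>) * E u" for \<eta> u
    by (simp add: f_def norm_mult E_def)
  have "integrable (lborel \<Otimes>\<^sub>M lborel) (case_prod f)"
  proof (rule lborel_pair.Fubini_integrable)
    show "case_prod f \<in> borel_measurable (lborel \<Otimes>\<^sub>M lborel)"
      using borel_measurable_continuous_UNIV[OF contf] by (simp add: lborel_prod)
    show "integrable lborel (\<lambda>\<eta>. LINT u|lborel. norm (case (\<eta>, u) of (x, xa) \<Rightarrow> f x xa))"
      using inth by (simp add: nf)
    show "AE \<eta> in lborel. integrable lborel (\<lambda>u. case (\<eta>, u) of (x, xa) \<Rightarrow> f x xa)"
    proof (rule AE_I2)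
      fix \<eta> :: "real ^ 'n"
      show "integrable lborel (\<lambda>u. case (\<eta>, u) of (x, xa) \<Rightarrow> f x xa)"
      proof (rule Bochner_Integration.integrable_bound)
        show "integrable lborel (\<lambda>u. cmod (h \<eta>) * E u)" using intE by simp
        show "(\<lambda>u. case (\<eta>, u) of (x, xa) \<Rightarrow> f x xa) \<in> borel_measurable lborel"
          unfolding f_def prod.case
          by (intro borel_measurable_continuous_UNIV continuous_intros contE)
        show "AE u in lborel. cmod (case (\<eta>, u) of (x, xa) \<Rightarrow> f x xa) \<le> norm (cmod (h \<eta>) * E u)"
          using nf by (auto simp: E_def)
      qed
    qed
  qed
  from lborel_pair.Fubini_integral[OF this]
  have fub: "(LINT u|lborel. LINT \<eta>|lborel. f \<eta> u) = (LINT \<eta>|lborel. LINT u|lborel. f \<eta> u)" .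
  have "(LINT u|lborel. g u * (cis (s * (y \<bullet> u)) * of_real (E u))) = (LINT u|lborel. LINT \<eta>|lborel. f \<eta> u)"
  proof (rule Bochner_Integration.integral_cong)
    fix u
    have "f \<eta> u = h \<eta> * cis (- (s * (\<eta> \<bullet> u))) * (cis (s * (y \<bullet> u)) * of_real (E u))" for \<eta>
      by (simp add: f_def inner_diff_left right_diff_distrib cis_mult flip: cis_divide)
        (simp add: divide_inverse mult_ac)
    then show "g u * (cis (s * (y \<bullet> u)) * of_real (E u)) = (LINT \<eta>|lborel. f \<eta> u)"
      by (simp add: g_def)
  qed simp
  also have "\<dots> = (LINT \<eta>|lborel. h \<eta> * A (y - \<eta>))"
    unfolding fub by (simp add: f_def A_def)
  \<comment> \<open>Substitution \<eta> = y - e v, so that y - \<eta> = e v.\<close>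
  also have "\<dots> = \<bar>- e\<bar> ^ DIM(real ^ 'n) *\<^sub>R (LINT v|lborel. h (y + (- e) *\<^sub>R v) * A (y - (y + (- e) *\<^sub>R v)))"
  proof (rule integral_affine_UNIV)
    have "(\<lambda>\<eta>. LINT u|lborel. f \<eta> u) \<in> borel_measurable lborel"
      using borel_measurable_continuous_UNIV[OF contf]
      by (intro lborel.borel_measurable_lebesgue_integral) (simp add: lborel_prod)
    then show "(\<lambda>\<eta>. h \<eta> * A (y - \<eta>)) \<in> borel_measurable lborel"
      by (simp add: f_def A_def)
  qed (use e in simp)
  also have "\<dots> = (LINT v|lborel. h (y - e *\<^sub>R v) * (e ^ DIM(real ^ 'n) *\<^sub>R A (e *\<^sub>R v)))"
    using e by (simp flip: integral_scaleR_right)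
  \<comment> \<open>The Jacobian of the substitution in \<eta> is the one that arises when u is
    replaced by e u in the integral defining \<gamma>.\<close>
  also have "(\<lambda>v. e ^ DIM(real ^ 'n) *\<^sub>R A (e *\<^sub>R v)) = \<gamma>"
  proof
    fix v
    have "\<gamma> v = \<bar>e\<bar> ^ DIM(real ^ 'n) *\<^sub>R (LINT u|lborel. complex_of_real (exp (- (norm (0 + e *\<^sub>R u :: real ^ 'n))\<^sup>2 / 2)) * cis (s * (v \<bullet> (0 + e *\<^sub>R u))))"
      unfolding \<gamma>_def using e
      by (intro integral_affine_UNIV borel_measurable_continuous_UNIV continuous_intros) auto
    then show "e ^ DIM(real ^ 'n) *\<^sub>R A (e *\<^sub>R v) = \<gamma> v"
      using e by (simp add: A_def E_def)
  qed
  finally show ?thesis by (simp add: E_def)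
qed

lemma integrable_gaussian:
  assumes "a \<noteq> 0"
  shows "integrable lborel (\<lambda>u :: real ^ 'n. exp (- (norm (a *\<^sub>R u))\<^sup>2 / 2))"
proof -
  obtain C where C: "\<And>u :: real ^ 'n. exp (- (a\<^sup>2 / 2) * (norm u)\<^sup>2) \<le> C * weight u"
    using gaussian_weight_bound[of "a\<^sup>2 / 2"] assms by auto
  show ?thesis
    using C by (intro integrable_weight_bound[where M = C] borel_measurable_continuous_UNIV continuous_intros)
      (auto simp: power_mult_distrib)
qed

text \<open>A vanishing integral of a strictly positive function would make the whole space a null
  set. Strict positivity is what later allows division by the inversion constant.\<close>

lemma gaussian_integral_pos:
  assumes "a \<noteq> 0"
  shows "0 < (LINT u|lborel. exp (- (norm (a *\<^sub>R (u :: real ^ 'n)))\<^sup>2 / 2))"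
proof -
  let ?I = "LINT u|lborel. exp (- (norm (a *\<^sub>R (u :: real ^ 'n)))\<^sup>2 / 2)"
  have "?I \<noteq> 0"
  proof
    assume "?I = 0"
    then have "AE u :: real ^ 'n in lborel. exp (- (norm (a *\<^sub>R u))\<^sup>2 / 2) = 0"
      by (subst (asm) integral_nonneg_eq_0_iff_AE[OF integrable_gaussian[OF assms]]) auto
    then have "ae_filter (lborel :: (real ^ 'n) measure) = bot"
      by (simp add: eventually_False)
    then show False by (simp add: ae_filter_eq_bot_iff)
  qed
  then show ?thesis
    by (simp add: order.not_eq_order_implies_strict)
qed

text \<open>Gaussian regularisation. The constant \<open>K\<close> equals \<open>(2\<pi>/s)\<^sup>n\<close>, but its value is never needed.\<close>

lemma fourier_inversion:
  assumes s: "0 < (s :: real)"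
  obtains K :: real where "0 < K"
    "\<And>(h :: real ^ 'n \<Rightarrow> complex) M M' y.
      \<lbrakk>continuous_on UNIV h; \<And>\<eta>. cmod (h \<eta>) \<le> M * weight \<eta>;
       continuous_on UNIV (\<lambda>u. LINT \<eta>|lborel. h \<eta> * cis (- (s * (\<eta> \<bullet> u))));
       \<And>u. cmod (LINT \<eta>|lborel. h \<eta> * cis (- (s * (\<eta> \<bullet> u)))) \<le> M' * weight u\<rbrakk> \<Longrightarrow>
      (LINT u|lborel. (LINT \<eta>|lborel. h \<eta> * cis (- (s * (\<eta> \<bullet> u)))) * cis (s * (y \<bullet> u))) = of_real K * h y"
proof -
  define k where "k = (LINT u|lborel. exp (- (norm (u :: real ^ 'n))\<^sup>2 / 2))"
  have k: "0 < k"
    using gaussian_integral_pos[of 1, where 'n = 'n] by (simp add: k_def)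
  define \<gamma> where "\<gamma> = (\<lambda>v :: real ^ 'n. LINT u|lborel. complex_of_real (exp (- (norm u)\<^sup>2 / 2)) * cis (s * (v \<bullet> u)))"
  have \<gamma>: "\<gamma> v = of_real (exp (- (norm (s *\<^sub>R v))\<^sup>2 / 2) * k)" for v
    using fourier_gaussian[of "s *\<^sub>R v"] by (simp only: \<gamma>_def k_def inner_scaleR_left)
  have int\<gamma>: "integrable lborel \<gamma>"
    unfolding \<gamma> using integrable_gaussian[of s, where 'n = 'n] s by auto
  \<comment> \<open>K is the integral of \<gamma>. It depends only on s and the dimension and is
    fixed before h, because one constant has to serve all slices \<eta> \<mapsto> G(x + i\<eta>) at
    once.\<close>
  define K where "K = (LINT v|lborel. exp (- (norm (s *\<^sub>R (v :: real ^ 'n)))\<^sup>2 / 2)) * k"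
  have "0 < K"
    unfolding K_def using gaussian_integral_pos[of s, where 'n = 'n] s k by simp
  moreover have "(LINT u|lborel. (LINT \<eta>|lborel. h \<eta> * cis (- (s * (\<eta> \<bullet> u)))) * cis (s * (y \<bullet> u))) = of_real K * h y"
    if h: "continuous_on UNIV h" "\<And>\<eta>. cmod (h \<eta>) \<le> M * weight \<eta>"
      and g: "continuous_on UNIV (\<lambda>u. LINT \<eta>|lborel. h \<eta> * cis (- (s * (\<eta> \<bullet> u))))"
       "\<And>u. cmod (LINT \<eta>|lborel. h \<eta> * cis (- (s * (\<eta> \<bullet> u)))) \<le> M' * weight u"
    for h :: "real ^ 'n \<Rightarrow> complex" and M M' y
  proof -
    define g where "g = (\<lambda>u. LINT \<eta>|lborel. h \<eta> * cis (- (s * (\<eta> \<bullet> u))))"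
    have g: "continuous_on UNIV g" "\<And>u. cmod (g u) \<le> M' * weight u"
      using g by (simp_all add: g_def)
    define e where "e = (\<lambda>k. inverse (real (Suc k)))"
    have e: "0 < e k" for k by (simp add: e_def)
    have lim_e: "e \<longlonglongrightarrow> 0" unfolding e_def by (rule LIMSEQ_inverse_real_of_nat)
    have "0 \<le> M * weight (0 :: real ^ 'n)"
      using order_trans[OF norm_ge_zero h(2)[of 0]] by simp
    then have M0: "0 \<le> M"
      using weight_pos[of "0 :: real ^ 'n"] by (simp add: zero_le_mult_iff not_le)
    have "(\<lambda>k. LINT u|lborel. g u * (cis (s * (y \<bullet> u)) * of_real (exp (- (norm (e k *\<^sub>R u))\<^sup>2 / 2))))
        \<longlonglongrightarrow> (LINT u|lborel. g u * cis (s * (y \<bullet> u)))"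
    proof (rule integral_dominated_convergence)
      show "integrable lborel (\<lambda>u :: real ^ 'n. M' * weight u)"
        by (intro integrable_mult_right integrable_weight)
      show "AE u in lborel. (\<lambda>k. g u * (cis (s * (y \<bullet> u)) * of_real (exp (- (norm (e k *\<^sub>R u))\<^sup>2 / 2))))
          \<longlonglongrightarrow> g u * cis (s * (y \<bullet> u))"
      proof (rule AE_I2)
        fix u :: "real ^ 'n"
        have "(\<lambda>k. g u * (cis (s * (y \<bullet> u)) * of_real (exp (- (norm (e k *\<^sub>R u))\<^sup>2 / 2))))
            \<longlonglongrightarrow> g u * (cis (s * (y \<bullet> u)) * of_real (exp (- (norm (0 *\<^sub>R u))\<^sup>2 / 2)))"
          by (intro tendsto_intros lim_e) simp
        then show "(\<lambda>k. g u * (cis (s * (y \<bullet> u)) * of_real (exp (- (norm (e k *\<^sub>R u))\<^sup>2 / 2))))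
            \<longlonglongrightarrow> g u * cis (s * (y \<bullet> u))" by simp
      qed
      show "AE u in lborel. cmod (g u * (cis (s * (y \<bullet> u)) * of_real (exp (- (norm (e k *\<^sub>R u))\<^sup>2 / 2)))) \<le> M' * weight u" for k
      proof (rule AE_I2)
        fix u :: "real ^ 'n"
        have "cmod (g u * (cis (s * (y \<bullet> u)) * of_real (exp (- (norm (e k *\<^sub>R u))\<^sup>2 / 2)))) \<le> cmod (g u) * 1"
          unfolding norm_mult by (intro mult_left_mono) (auto simp: norm_mult)
        then show "cmod (g u * (cis (s * (y \<bullet> u)) * of_real (exp (- (norm (e k *\<^sub>R u))\<^sup>2 / 2)))) \<le> M' * weight u"
          using g(2)[of u] by simp
      qed
    qed (intro borel_measurable_continuous_UNIV continuous_intros g; simp)+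
    \<comment> \<open>Continuity of h at y gives the pointwise limit. As h is bounded by M, the
      integrable \<gamma> provides the majorant.\<close>
    moreover have "(\<lambda>k. LINT v|lborel. h (y - e k *\<^sub>R v) * \<gamma> v) \<longlonglongrightarrow> (LINT v|lborel. h y * \<gamma> v)"
    proof (rule integral_dominated_convergence)
      show "integrable lborel (\<lambda>v. M * cmod (\<gamma> v))"
        using int\<gamma> by auto
      show "AE v in lborel. (\<lambda>k. h (y - e k *\<^sub>R v) * \<gamma> v) \<longlonglongrightarrow> h y * \<gamma> v"
      proof (rule AE_I2)
        fix v :: "real ^ 'n"
        have "(\<lambda>k. y - e k *\<^sub>R v) \<longlonglongrightarrow> y"
          by (rule tendsto_eq_intros lim_e refl | simp)+
        moreover have "isCont h y"
          using h(1) by (simp add: continuous_on_eq_continuous_at)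
        ultimately show "(\<lambda>k. h (y - e k *\<^sub>R v) * \<gamma> v) \<longlonglongrightarrow> h y * \<gamma> v"
          by (intro tendsto_intros isCont_tendsto_compose[where g = h])
      qed
      show "AE v in lborel. cmod (h (y - e k *\<^sub>R v) * \<gamma> v) \<le> M * cmod (\<gamma> v)" for k
      proof (rule AE_I2)
        fix v :: "real ^ 'n"
        have "cmod (h (y - e k *\<^sub>R v)) \<le> M"
          using order_trans[OF h(2) mult_left_mono[OF weight_le_1 M0]] by simp
        then show "cmod (h (y - e k *\<^sub>R v) * \<gamma> v) \<le> M * cmod (\<gamma> v)"
          by (simp add: norm_mult mult_right_mono)
      qed
      have c\<gamma>: "continuous_on UNIV \<gamma>"
        unfolding \<gamma> by (intro continuous_intros) simp
      show "(\<lambda>v. h y * \<gamma> v) \<in> borel_measurable lborel"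
        by (intro borel_measurable_continuous_UNIV continuous_intros c\<gamma>)
      have "continuous_on UNIV (\<lambda>v. h (y - e k *\<^sub>R v))" for k
        by (rule continuous_on_compose2[OF h(1)]) (auto intro!: continuous_intros)
      then show "(\<lambda>v. h (y - e k *\<^sub>R v) * \<gamma> v) \<in> borel_measurable lborel" for k
        by (intro borel_measurable_continuous_UNIV continuous_intros c\<gamma>)
    qed
    moreover have "(LINT u|lborel. g u * (cis (s * (y \<bullet> u)) * of_real (exp (- (norm (e k *\<^sub>R u))\<^sup>2 / 2))))
        = (LINT v|lborel. h (y - e k *\<^sub>R v) * \<gamma> v)" for k
      unfolding g_def \<gamma>_def by (rule fourier_inversion_aux[OF h e])
    ultimately have "(LINT u|lborel. g u * cis (s * (y \<bullet> u))) = (LINT v|lborel. h y * \<gamma> v)"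
      using LIMSEQ_unique by simp
    also have "\<dots> = h y * (LINT v|lborel. \<gamma> v)"
      by simp
    also have "(LINT v|lborel. \<gamma> v) = of_real K"
      unfolding \<gamma> K_def integral_complex_of_real by simp
    finally show ?thesis by (simp add: g_def mult.commute)
  qed
  ultimately show ?thesis using that by blast
qed

section \<open>Schwartz functions\<close>

lemma has_vector_derivative_along:
  fixes f f' :: "'a::real_vector \<Rightarrow> 'b::real_normed_vector"
  assumes "\<And>x. ((\<lambda>r. f (x + r *\<^sub>R a)) has_vector_derivative f' x) (at 0)"
  shows "((\<lambda>r. f (x + r *\<^sub>R a)) has_vector_derivative f' (x + r *\<^sub>R a)) (at r)"
  using assms[of "x + r *\<^sub>R a"]
  unfolding has_vector_derivative_def has_derivative_at
  by (simp add: scaleR_add_left add.assoc)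

text \<open>By translation invariance every difference quotient of h along a has integral 0, and the
  quotients converge pointwise to h'. The mean value theorem bounds them by values of h' at nearby
  points, hence by a multiple of the weight. Applied to a product, this is integration by
  parts.\<close>

lemma integral_directional_derivative_eq_0:
  fixes h h' :: "real ^ 'n \<Rightarrow> complex"
  assumes h: "continuous_on UNIV h" "\<And>u. cmod (h u) \<le> M * weight u"
    and h': "continuous_on UNIV h'" "\<And>u. cmod (h' u) \<le> M' * weight u"
    and der: "\<And>x. ((\<lambda>r. h (x + r *\<^sub>R a)) has_vector_derivative h' x) (at 0)"
  shows "(LINT u|lborel. h' u) = 0"
proof -
  define e where "e = (\<lambda>k. inverse (real (Suc k)))"
  have e: "0 < e k" "e k \<le> 1" for k by (simp_all add: e_def inverse_le_1_iff)
  have lim_e: "e \<longlonglongrightarrow> 0" unfolding e_def by (rule LIMSEQ_inverse_real_of_nat)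
  define q where "q = (\<lambda>k u. (h (u + e k *\<^sub>R a) - h u) /\<^sub>R e k)"
  \<comment> \<open>The mean value theorem evaluates h' at points u + r a with |r| at most 1; the
    factor compares the weight there with the weight at u.\<close>
  define M'' where "M'' = M' * (2 * (1 + (norm a)\<^sup>2)) ^ CARD('n)"
  have "0 \<le> M' * weight (0 :: real ^ 'n)"
    using order_trans[OF norm_ge_zero h'(2)[of 0]] by simp
  then have M'0: "0 \<le> M'"
    using weight_pos[of "0 :: real ^ 'n"] by (simp add: zero_le_mult_iff not_le)
  have conth: "continuous_on UNIV (\<lambda>u. h (u + b))" for b
    by (rule continuous_on_compose2[OF h(1)]) (auto intro!: continuous_intros)
  have mh: "(\<lambda>u. h (u + b)) \<in> borel_measurable lborel" for b
    by (intro borel_measurable_continuous_UNIV conth)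
  have ih: "integrable lborel (\<lambda>u. h (u + b))" for b
  proof (rule integrable_weight_bound[OF mh])
    fix y
    have "0 \<le> M * weight (0 :: real ^ 'n)"
      using order_trans[OF norm_ge_zero h(2)[of 0]] by simp
    then have "0 \<le> M"
      using weight_pos[of "0 :: real ^ 'n"] by (simp add: zero_le_mult_iff not_le)
    then have "M * weight (y + b) \<le> M * ((2 * (1 + (norm b)\<^sup>2)) ^ CARD('n) * weight y)"
      using weight_translate_le[of "y + b" "- b"] by (intro mult_left_mono) auto
    then show "cmod (h (y + b)) \<le> (M * (2 * (1 + (norm b)\<^sup>2)) ^ CARD('n)) * weight y"
      using h(2)[of "y + b"] by simp
  qed
  have h'_bound: "cmod (h' (u + r *\<^sub>R a)) \<le> M'' * weight u" if "\<bar>r\<bar> \<le> 1" for u r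
  proof -
    have "cmod (h' (u + r *\<^sub>R a)) \<le> M' * weight (u + r *\<^sub>R a)" by (rule h')
    also have "\<dots> \<le> M' * ((2 * (1 + (norm (r *\<^sub>R a))\<^sup>2)) ^ CARD('n) * weight u)"
      using weight_translate_le[of "u + r *\<^sub>R a" "- (r *\<^sub>R a)"] M'0 by (intro mult_left_mono) auto
    also have "\<dots> \<le> M' * ((2 * (1 + (norm a)\<^sup>2)) ^ CARD('n) * weight u)"
    proof -
      have "norm (r *\<^sub>R a) \<le> norm a"
        using mult_right_mono[OF that norm_ge_zero[of a]] by simp
      then have "(norm (r *\<^sub>R a))\<^sup>2 \<le> (norm a)\<^sup>2"
        by (intro power_mono) auto
      then show ?thesis
        using M'0 by (intro mult_left_mono mult_right_mono power_mono) (auto simp: weight_pos less_imp_le)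
    qed
    finally show ?thesis by (simp add: M''_def mult.assoc)
  qed
  have "(\<lambda>k. LINT u|lborel. q k u) \<longlonglongrightarrow> (LINT u|lborel. h' u)"
  proof (rule integral_dominated_convergence)
    show "h' \<in> borel_measurable lborel" by (intro borel_measurable_continuous_UNIV h')
    show "q k \<in> borel_measurable lborel" for k
      unfolding q_def by (intro borel_measurable_continuous_UNIV continuous_intros conth h(1))
    show "integrable lborel (\<lambda>u :: real ^ 'n. M'' * weight u)"
      by (intro integrable_mult_right integrable_weight)
    show "AE u in lborel. (\<lambda>k. q k u) \<longlonglongrightarrow> h' u"
    proof (rule AE_I2)
      fix u :: "real ^ 'n"
      have "((\<lambda>r. norm (h (u + r *\<^sub>R a) - h u - r *\<^sub>R h' u) / norm r) \<longlongrightarrow> 0) (at 0)"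
        using der[of u] by (simp add: has_vector_derivative_def has_derivative_at)
      moreover have "filterlim e (at 0) sequentially"
        using e(1) by (auto simp: filterlim_at lim_e intro!: always_eventually less_imp_neq[THEN not_sym])
      ultimately have "(\<lambda>k. norm (h (u + e k *\<^sub>R a) - h u - e k *\<^sub>R h' u) / norm (e k)) \<longlonglongrightarrow> 0"
        by (rule filterlim_compose)
      moreover have "norm (h (u + e k *\<^sub>R a) - h u - e k *\<^sub>R h' u) / norm (e k) = norm (q k u - h' u)" for k
      proof -
        have "q k u - h' u = (h (u + e k *\<^sub>R a) - h u - e k *\<^sub>R h' u) /\<^sub>R e k"
          using e(1)[of k] by (simp add: q_def scaleR_diff_right)
        then show ?thesis by (simp add: divide_inverse mult.commute)
      qed
      ultimately have "(\<lambda>k. norm (q k u - h' u)) \<longlonglongrightarrow> 0" by simp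
      then show "(\<lambda>k. q k u) \<longlonglongrightarrow> h' u"
        using Lim_null tendsto_norm_zero_iff by blast
    qed
    show "AE u in lborel. cmod (q k u) \<le> M'' * weight u" for k
    proof (rule AE_I2)
      fix u :: "real ^ 'n"
      note d = has_vector_derivative_along[of h a h', OF der, of u]
      have "\<exists>r\<in>{0<..<e k}. norm (h (u + e k *\<^sub>R a) - h (u + 0 *\<^sub>R a)) \<le> norm ((e k - 0) *\<^sub>R h' (u + r *\<^sub>R a))"
      proof (rule mvt_general[OF e(1)])
        show "continuous_on {0..e k} (\<lambda>r. h (u + r *\<^sub>R a))"
          by (intro continuous_at_imp_continuous_on ballI has_vector_derivative_continuous[OF d])
      qed (use d in \<open>simp add: has_vector_derivative_def\<close>)
      then obtain r where r: "0 < r" "r < e k" "norm (h (u + e k *\<^sub>R a) - h u) \<le> e k * norm (h' (u + r *\<^sub>R a))"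
        using e(1)[of k] by auto
      have "norm (h' (u + r *\<^sub>R a)) \<le> M'' * weight u"
        using r e[of k] by (intro h'_bound) auto
      then have "norm (h (u + e k *\<^sub>R a) - h u) \<le> e k * (M'' * weight u)"
        using e(1)[of k] by (intro order_trans[OF r(3)] mult_left_mono) auto
      then show "cmod (q k u) \<le> M'' * weight u"
        using e(1)[of k] by (simp add: q_def divide_inverse_commute[symmetric] divide_le_eq mult.commute)
    qed
  qed
  moreover have "(LINT u|lborel. q k u) = 0" for k
    unfolding q_def using integral_translate[OF mh[of 0], of "e k *\<^sub>R a"] ih[of 0] ih[of "e k *\<^sub>R a"]
    by simp
  ultimately show ?thesis
    by (simp add: LIMSEQ_const_iff)
qed

text \<open>The module over the polynomials generated by \<open>S\<close>. By the product rule it is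
  stable under differentiation as soon as it contains the partial derivatives of its
  generators.\<close>

inductive_set poly_span :: "(real ^ 'n \<Rightarrow> complex) set \<Rightarrow> (real ^ 'n \<Rightarrow> complex) set"
  for S where
  base: "f \<in> S \<Longrightarrow> f \<in> poly_span S"
| coord: "f \<in> poly_span S \<Longrightarrow> (\<lambda>u. of_real (u $ j) * f u) \<in> poly_span S"
| add: "f \<in> poly_span S \<Longrightarrow> g \<in> poly_span S \<Longrightarrow> (\<lambda>u. f u + g u) \<in> poly_span S"
| scale: "f \<in> poly_span S \<Longrightarrow> (\<lambda>u. c * f u) \<in> poly_span S"

lemma prod_power_upd_Suc:
  "(\<Prod>k\<in>UNIV. (x $ k) ^ (\<alpha>(j := Suc (\<alpha> j))) k) = (x :: real ^ 'n) $ j * (\<Prod>k\<in>UNIV. (x $ k) ^ \<alpha> k)"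
proof -
  have "(\<Prod>k\<in>UNIV. (x $ k) ^ (\<alpha>(j := Suc (\<alpha> j))) k) =
      (x $ j) ^ Suc (\<alpha> j) * (\<Prod>k\<in>UNIV - {j}. (x $ k) ^ (\<alpha>(j := Suc (\<alpha> j))) k)"
    by (subst prod.remove[of _ j]) auto
  also have "(\<Prod>k\<in>UNIV - {j}. (x $ k) ^ (\<alpha>(j := Suc (\<alpha> j))) k) = (\<Prod>k\<in>UNIV - {j}. (x $ k) ^ \<alpha> k)"
    by (rule prod.cong) auto
  also have "(x $ j) ^ Suc (\<alpha> j) * \<dots> = x $ j * (\<Prod>k\<in>UNIV. (x $ k) ^ \<alpha> k)"
    by (subst prod.remove[of UNIV j]) auto
  finally show ?thesis .
qed

text \<open>Stability under partial derivatives places all iterated derivatives in the span.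
  Continuity and boundedness against monomials then have to be known for members of the span only,
  and they are inherited from the generators, so no formula for a higher derivative is ever written
  down.\<close>

lemma poly_span_subset_schwartz_space:
  fixes S :: "(real ^ 'n \<Rightarrow> complex) set"
  assumes cont: "\<And>f. f \<in> S \<Longrightarrow> continuous_on UNIV f"
    and bound: "\<And>f \<alpha>. f \<in> S \<Longrightarrow> \<exists>C. \<forall>x. cmod (complex_of_real (\<Prod>j\<in>UNIV. (x $ j) ^ \<alpha> j) * f x) \<le> C"
    and deriv: "\<And>f j. f \<in> S \<Longrightarrow>
      \<exists>g\<in>poly_span S. \<forall>x. ((\<lambda>r. f (x + r *\<^sub>R axis j 1)) has_vector_derivative g x) (at 0)"
  shows "poly_span S \<subseteq> schwartz_space"
proof
  have cont: "continuous_on UNIV f" if "f \<in> poly_span S" for f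
    using that by induction (auto intro: cont intro!: continuous_intros)
  have bound: "\<exists>C. \<forall>x. cmod (complex_of_real (\<Prod>j\<in>UNIV. (x $ j) ^ \<alpha> j) * f x) \<le> C"
    if "f \<in> poly_span S" for f \<alpha>
    using that
  proof (induction arbitrary: \<alpha>)
    case (coord f j)
    \<comment> \<open>The coordinate factor is absorbed by raising one exponent, which is why the
      induction keeps \<alpha> arbitrary.\<close>
    from coord.IH[of "\<alpha>(j := Suc (\<alpha> j))"] show ?case
      unfolding prod_power_upd_Suc by (simp add: mult_ac)
  next
    case (add f g)
    from add.IH(1)[of \<alpha>] add.IH(2)[of \<alpha>] obtain C D where
      "\<forall>x. cmod (complex_of_real (\<Prod>j\<in>UNIV. (x $ j) ^ \<alpha> j) * f x) \<le> C"
      "\<forall>x. cmod (complex_of_real (\<Prod>j\<in>UNIV. (x $ j) ^ \<alpha> j) * g x) \<le> D" by blast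
    then have "\<forall>x. cmod (complex_of_real (\<Prod>j\<in>UNIV. (x $ j) ^ \<alpha> j) * (f x + g x)) \<le> C + D"
      by (auto simp: distrib_left intro!: norm_triangle_le add_mono)
    then show ?case ..
  next
    case (scale f c)
    from scale.IH[of \<alpha>] obtain C where
      "\<forall>x. cmod (complex_of_real (\<Prod>j\<in>UNIV. (x $ j) ^ \<alpha> j) * f x) \<le> C" by blast
    then have "\<forall>x. cmod c * cmod (complex_of_real (\<Prod>j\<in>UNIV. (x $ j) ^ \<alpha> j) * f x) \<le> cmod c * C"
      by (auto intro: mult_left_mono)
    then have "\<forall>x. cmod (complex_of_real (\<Prod>j\<in>UNIV. (x $ j) ^ \<alpha> j) * (c * f x)) \<le> cmod c * C"
      by (simp add: norm_mult mult_ac)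
    then show ?case ..
  qed (use bound in blast)
  have deriv: "\<exists>g\<in>poly_span S. \<forall>x. ((\<lambda>r. f (x + r *\<^sub>R axis j 1)) has_vector_derivative g x) (at 0)"
    if "f \<in> poly_span S" for f j
    using that
  proof induction
    case (coord f i)
    then obtain g where g: "g \<in> poly_span S" "\<And>x. ((\<lambda>r. f (x + r *\<^sub>R axis j 1)) has_vector_derivative g x) (at 0)"
      by blast
    have "((\<lambda>r. ((x + r *\<^sub>R axis j 1) $ i) *\<^sub>R f (x + r *\<^sub>R axis j 1)) has_vector_derivative
        ((x + 0 *\<^sub>R axis j 1) $ i) *\<^sub>R g x + (axis j 1 $ i) *\<^sub>R f (x + 0 *\<^sub>R axis j 1)) (at 0)" for x
      by (rule has_vector_derivative_scaleR[OF _ g(2)]) (auto intro!: derivative_eq_intros)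
    then have "((\<lambda>r. of_real ((x + r *\<^sub>R axis j 1) $ i) * f (x + r *\<^sub>R axis j 1)) has_vector_derivative
        (of_real (x $ i) * g x + of_real (axis j 1 $ i) * f x)) (at 0)" for x
      by (simp add: scaleR_conv_of_real)
    moreover have "(\<lambda>x. of_real (x $ i) * g x + of_real (axis j 1 $ i) * f x) \<in> poly_span S"
      by (intro poly_span.intros g coord)
    ultimately show ?case by (intro bexI[rotated]) auto
  next
    case (add f g)
    then obtain f' g' where "f' \<in> poly_span S" "\<And>x. ((\<lambda>r. f (x + r *\<^sub>R axis j 1)) has_vector_derivative f' x) (at 0)"
      "g' \<in> poly_span S" "\<And>x. ((\<lambda>r. g (x + r *\<^sub>R axis j 1)) has_vector_derivative g' x) (at 0)"
      by blast
    then show ?case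
      by (intro bexI[of _ "\<lambda>x. f' x + g' x"] allI has_vector_derivative_add poly_span.add)
  next
    case (scale f c)
    then obtain g where "g \<in> poly_span S" "\<And>x. ((\<lambda>r. f (x + r *\<^sub>R axis j 1)) has_vector_derivative g x) (at 0)"
      by blast
    then show ?case
      by (intro bexI[of _ "\<lambda>x. c * g x"] allI has_vector_derivative_mult_right poly_span.scale)
  qed (use deriv in blast)
  fix f assume f: "f \<in> poly_span S"
  have "partial_deriv j g \<in> poly_span S" if g: "g \<in> poly_span S" for j g
  proof -
    obtain g' where g': "g' \<in> poly_span S" "\<And>x. ((\<lambda>r. g (x + r *\<^sub>R axis j 1)) has_vector_derivative g' x) (at 0)"
      using deriv[OF g] by blast
    then have "partial_deriv j g = g'"
      by (auto simp: partial_deriv_def fun_eq_iff intro: vector_derivative_at)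
    with g' show ?thesis by simp
  qed
  then have "iter_partial js f \<in> poly_span S" for js
    by (induction js) (auto simp: f)
  moreover have "(\<lambda>r. g (x + r *\<^sub>R axis j 1)) differentiable (at 0)" if "g \<in> poly_span S" for g j x
    using deriv[OF that, of j] by (auto intro: differentiableI_vector)
  ultimately show "f \<in> schwartz_space"
    unfolding schwartz_space_def smooth_Rn_def using cont bound by blast
qed

section \<open>Closure properties of the Schwartz space\<close>

lemma schwartz_space_continuous: "f \<in> schwartz_space \<Longrightarrow> continuous_on UNIV f"
  unfolding schwartz_space_def smooth_Rn_def by (auto dest!: spec[of _ "[]"])

lemma schwartz_space_prod_bounded:
  assumes "f \<in> schwartz_space"
  shows "\<exists>C. \<forall>x. cmod (complex_of_real (\<Prod>j\<in>UNIV. (x $ j) ^ \<alpha> j) * f x) \<le> C"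
proof -
  have "\<exists>C. \<forall>x. cmod (complex_of_real (\<Prod>j\<in>UNIV. (x $ j) ^ \<alpha> j) * iter_partial [] f x) \<le> C"
    using assms unfolding schwartz_space_def by blast
  then show ?thesis by simp
qed

lemma schwartz_space_bounded: "f \<in> schwartz_space \<Longrightarrow> \<exists>C. \<forall>x. cmod (f x) \<le> C"
  using schwartz_space_prod_bounded[of f "\<lambda>_. 0"] by simp

lemma schwartz_space_partial_deriv:
  assumes "f \<in> schwartz_space"
  shows "partial_deriv j f \<in> schwartz_space"
proof -
  \<comment> \<open>The list is consumed from the outside in: its last entry is the derivative taken
    first.\<close>
  have "iter_partial js (partial_deriv j f) = iter_partial (js @ [j]) f" for js
    by (induction js) auto
  then show ?thesis
    using assms unfolding schwartz_space_def smooth_Rn_def by simp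
qed

lemma schwartz_space_has_partial_deriv:
  assumes "f \<in> schwartz_space"
  shows "((\<lambda>r. f (x + r *\<^sub>R axis j 1)) has_vector_derivative partial_deriv j f x) (at 0)"
  using assms unfolding schwartz_space_def smooth_Rn_def partial_deriv_def
  by (auto simp flip: vector_derivative_works dest!: spec[of _ "[]"])

text \<open>With the Schwartz space as its own generating set, closure under sums, scalars and
  coordinate multiplication comes out of the span in one stroke.\<close>

lemma poly_span_schwartz_space: "poly_span schwartz_space = schwartz_space"
proof
  show "poly_span schwartz_space \<subseteq> schwartz_space"
    by (rule poly_span_subset_schwartz_space)
      (blast intro: schwartz_space_continuous schwartz_space_prod_bounded
        schwartz_space_has_partial_deriv poly_span.base schwartz_space_partial_deriv)+
qed (auto intro: poly_span.base)

text \<open>Half of the quadratic exponent pays for the linear term by completing the square, at the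
  cost of a constant depending on b; the other half dominates the weight.\<close>

lemma gaussian_linear_weight_bound:
  assumes a: "0 < a"
  obtains C where "0 \<le> C" "\<And>u :: real ^ 'n. exp (- a * (norm u)\<^sup>2 + b \<bullet> u) \<le> C * weight u"
proof -
  obtain C where C: "0 \<le> C" "\<And>u :: real ^ 'n. exp (- (a / 2) * (norm u)\<^sup>2) \<le> C * weight u"
    using gaussian_weight_bound[of "a / 2"] a by auto
  have "exp (- a * (norm u)\<^sup>2 + b \<bullet> u) \<le> (exp ((norm b)\<^sup>2 / (2 * a)) * C) * weight u" for u :: "real ^ 'n"
  proof -
    have "0 \<le> (a / 2) * (norm (u - (1 / a) *\<^sub>R b))\<^sup>2"
      using a by simp
    also have "\<dots> = (a / 2) * (norm u)\<^sup>2 - b \<bullet> u + (norm b)\<^sup>2 / (2 * a)"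
      using a unfolding power2_norm_eq_inner
      by (simp add: inner_diff_left inner_diff_right inner_commute field_simps)
    finally have "exp (- a * (norm u)\<^sup>2 + b \<bullet> u) \<le> exp ((norm b)\<^sup>2 / (2 * a) + - (a / 2) * (norm u)\<^sup>2)"
      by simp
    also have "\<dots> \<le> exp ((norm b)\<^sup>2 / (2 * a)) * (C * weight u)"
      unfolding exp_add by (intro mult_left_mono C) simp
    finally show ?thesis by simp
  qed
  then show ?thesis using that[of "exp ((norm b)\<^sup>2 / (2 * a)) * C"] C(1) by simp
qed

section \<open>The Gaussian integral transform\<close>

text \<open>The Mehler kernel without the factors that do not involve u. Keeping c and s as free
  parameters allows negative c, which gives a growing Gaussian.\<close>

definition gauss_kernel :: "real \<Rightarrow> real \<Rightarrow> complex ^ 'n \<Rightarrow> real ^ 'n \<Rightarrow> complex" where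
  "gauss_kernel c s z u =
     exp (of_real (- (c / 2) * (norm u)\<^sup>2) + of_real s * scalar_product z (of_real_vec u))"

definition gauss_transform :: "real \<Rightarrow> real \<Rightarrow> (real ^ 'n \<Rightarrow> complex) \<Rightarrow> complex ^ 'n \<Rightarrow> complex" where
  "gauss_transform c s f z = (LINT u|lborel. f u * gauss_kernel c s z u)"

lemma norm_gauss_kernel:
  "cmod (gauss_kernel c s (cvec x y) u) = exp (- (c / 2) * (norm u)\<^sup>2 + (s *\<^sub>R x) \<bullet> u)"
  by (simp add: gauss_kernel_def scalar_product_cvec)

lemma continuous_on_gauss_kernel [continuous_intros]: "continuous_on S (gauss_kernel c s z)"
  unfolding gauss_kernel_def scalar_product_def vec_lambda_beta
  by (intro continuous_intros)

lemma gauss_kernel_weight_bound: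
  assumes "0 < c"
  obtains C where "0 \<le> C" "\<And>u. cmod (gauss_kernel c s z u) \<le> C * weight u"
proof -
  obtain x y where z: "z = cvec x y" using cvec_Re_Im by blast
  show ?thesis
    using gaussian_linear_weight_bound[of "c / 2" "s *\<^sub>R x"] assms that
    unfolding z norm_gauss_kernel by auto
qed

lemma gauss_kernel_mult_weight_bound:
  assumes c: "0 < c" and f: "\<And>u. cmod (f u) \<le> B"
  shows "\<exists>C. \<forall>u. cmod (f u * gauss_kernel c s z u) \<le> C * weight u"
proof -
  obtain C where C: "0 \<le> C" "\<And>u. cmod (gauss_kernel c s z u) \<le> C * weight u"
    using gauss_kernel_weight_bound[OF c] by blast
  have "cmod (f u * gauss_kernel c s z u) \<le> (B * C) * weight u" for u
    unfolding norm_mult mult.assoc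
    using order_trans[OF norm_ge_zero f] by (intro mult_mono f C) auto
  then show ?thesis by blast
qed

lemma integrable_gauss_kernel_mult:
  assumes c: "0 < c" and f: "continuous_on UNIV f" "\<And>u. cmod (f u) \<le> B"
  shows "integrable lborel (\<lambda>u. f u * gauss_kernel c s z u)"
proof -
  obtain C where C: "\<And>u. cmod (f u * gauss_kernel c s z u) \<le> C * weight u"
    using gauss_kernel_mult_weight_bound[where f = f, OF c f(2)] by blast
  show ?thesis
    by (rule integrable_weight_bound[OF _ C])
      (intro borel_measurable_continuous_UNIV continuous_intros f(1))
qed

lemma gauss_transform_bound:
  fixes f :: "real ^ 'n \<Rightarrow> complex"
  assumes c: "0 < c" and f: "continuous_on UNIV f" "\<And>u. cmod (f u) \<le> B"
  shows "cmod (gauss_transform c s f (cvec x y)) \<le>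
    (B * (LINT u|lborel. exp (- (c / 2) * (norm (u :: real ^ 'n))\<^sup>2))) * exp (s\<^sup>2 / (2 * c) * (norm x)\<^sup>2)"
proof -
  define Q where "Q = (\<lambda>u. exp (- (c / 2) * (norm u)\<^sup>2 + (s *\<^sub>R x) \<bullet> u))"
  have contQ: "continuous_on UNIV Q" unfolding Q_def by (intro continuous_intros)
  obtain C where "\<And>u. Q u \<le> C * weight u"
    using gaussian_linear_weight_bound[of "c / 2" "s *\<^sub>R x"] c unfolding Q_def by auto
  then have intQ: "integrable lborel Q"
    by (intro integrable_weight_bound[where M = C] borel_measurable_continuous_UNIV contQ)
      (simp add: Q_def)
  \<comment> \<open>The square is centred at (s/c) x. Translating the centre away leaves an integral
    that no longer depends on x.\<close>
  have "Q u = exp (s\<^sup>2 / (2 * c) * (norm x)\<^sup>2) * exp (- (c / 2) * (norm (u + (- s / c) *\<^sub>R x))\<^sup>2)" for u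
  proof -
    have "- (c / 2) * (norm u)\<^sup>2 + (s *\<^sub>R x) \<bullet> u =
        s\<^sup>2 / (2 * c) * (norm x)\<^sup>2 + - (c / 2) * (norm (u + (- s / c) *\<^sub>R x))\<^sup>2"
      using c unfolding power2_norm_eq_inner
      by (simp add: inner_add_left inner_add_right inner_diff_left inner_diff_right inner_commute field_simps power2_eq_square)
    then show ?thesis by (simp only: Q_def flip: exp_add)
  qed
  then have "(LINT u|lborel. Q u) =
      exp (s\<^sup>2 / (2 * c) * (norm x)\<^sup>2) * (LINT u|lborel. exp (- (c / 2) * (norm (u + (- s / c) *\<^sub>R x))\<^sup>2))"
    by simp
  also have "(LINT u|lborel. exp (- (c / 2) * (norm (u + (- s / c) *\<^sub>R x))\<^sup>2)) =
      (LINT u|lborel. exp (- (c / 2) * (norm (u :: real ^ 'n))\<^sup>2))"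
    by (intro integral_translate borel_measurable_continuous_UNIV continuous_intros)
  finally have Q: "(LINT u|lborel. Q u) = exp (s\<^sup>2 / (2 * c) * (norm x)\<^sup>2) * (LINT u|lborel. exp (- (c / 2) * (norm (u :: real ^ 'n))\<^sup>2))" .
  have "cmod (gauss_transform c s f (cvec x y)) \<le> (LINT u|lborel. B * Q u)"
    unfolding gauss_transform_def
  proof (rule Bochner_Integration.integral_norm_bound_integral)
    show "integrable lborel (\<lambda>u. f u * gauss_kernel c s (cvec x y) u)"
      by (rule integrable_gauss_kernel_mult[OF c f])
    show "integrable lborel (\<lambda>u. B * Q u)" using intQ by simp
    show "cmod (f u * gauss_kernel c s (cvec x y) u) \<le> B * Q u" for u
      using f(2)[of u] by (simp add: norm_mult norm_gauss_kernel Q_def mult_right_mono)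
  qed
  then show ?thesis using Q by (simp add: mult_ac)
qed

lemma gauss_kernel_axis_derivative:
  "((\<lambda>r. gauss_kernel c s z (u + r *\<^sub>R axis j 1)) has_vector_derivative
     (of_real s * z $ j - of_real (c * u $ j)) * gauss_kernel c s z u) (at 0)"
proof -
  define A where "A = of_real (- (c / 2) * (norm u)\<^sup>2) + of_real s * scalar_product z (of_real_vec u)"
  define B where "B = of_real s * z $ j - of_real (c * u $ j)"
  have n: "(norm (u + r *\<^sub>R axis j 1))\<^sup>2 = (norm u)\<^sup>2 + 2 * r * u $ j + r\<^sup>2" for r
    unfolding power2_norm_eq_inner
    by (simp add: inner_add_left inner_add_right inner_axis inner_axis' power2_eq_square distrib_left)
  have "scalar_product z (of_real_vec (u + r *\<^sub>R axis j 1)) = scalar_product z (of_real_vec u) + of_real r * z $ j" for r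
    by (simp add: scalar_product_def distrib_left sum.distrib axis_def
        if_distrib[of "\<lambda>x. _ * x"] if_distrib[of complex_of_real] cong: if_cong)
  then have E: "gauss_kernel c s z (u + r *\<^sub>R axis j 1) =
      exp (A + of_real r * B + (of_real r)\<^sup>2 * of_real (- (c / 2)))" for r
    unfolding gauss_kernel_def n by (simp add: A_def B_def algebra_simps)
  \<comment> \<open>Along the axis the exponent is a quadratic polynomial in r with linear
    coefficient B. It is differentiated in a complex variable and then restricted to real
    parameters.\<close>
  have "((\<lambda>w. exp (A + w * B + w\<^sup>2 * of_real (- (c / 2)))) has_field_derivative B * exp A) (at (of_real 0))"
    by (auto intro!: derivative_eq_intros)
  from has_vector_derivative_real_field[OF this] show ?thesis
    unfolding E by (simp add: A_def B_def gauss_kernel_def)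
qed

lemma schwartz_space_coord: "f \<in> schwartz_space \<Longrightarrow> (\<lambda>u. of_real (u $ j) * f u) \<in> schwartz_space"
  using poly_span.coord[of f schwartz_space j] unfolding poly_span_schwartz_space .

lemma schwartz_space_add: "f \<in> schwartz_space \<Longrightarrow> g \<in> schwartz_space \<Longrightarrow> (\<lambda>u. f u + g u) \<in> schwartz_space"
  using poly_span.add[of f schwartz_space g] unfolding poly_span_schwartz_space .

lemma schwartz_space_scale: "f \<in> schwartz_space \<Longrightarrow> (\<lambda>u. k * f u) \<in> schwartz_space"
  using poly_span.scale[of f schwartz_space k] unfolding poly_span_schwartz_space .

lemma gauss_transform_coord:
  fixes f :: "real ^ 'n \<Rightarrow> complex"
  assumes c: "0 < c" and s: "s \<noteq> 0" and f: "f \<in> schwartz_space"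
  obtains g where "g \<in> schwartz_space" "\<And>z. z $ j * gauss_transform c s f z = gauss_transform c s g z"
proof -
  define k :: complex where "k = of_real (1 / s)"
  define f1 f2 where "f1 = (\<lambda>u. of_real c * (of_real (u $ j) * f u))" and "f2 = partial_deriv j f"
  have S: "f1 \<in> schwartz_space" "f2 \<in> schwartz_space"
    unfolding f1_def f2_def by (intro schwartz_space_scale schwartz_space_coord schwartz_space_partial_deriv f)+
  define g where "g = (\<lambda>u. k * (f1 u + (-1) * f2 u))"
  have "g \<in> schwartz_space"
    unfolding g_def by (intro schwartz_space_scale schwartz_space_add S)
  moreover have "z $ j * gauss_transform c s f z = gauss_transform c s g z" for z
  proof -
    let ?K = "gauss_kernel c s z"
    have int: "integrable lborel (\<lambda>u. f u * ?K u)" if "f \<in> schwartz_space" for f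
      using schwartz_space_bounded[OF that] integrable_gauss_kernel_mult[OF c schwartz_space_continuous[OF that]]
      by blast
    \<comment> \<open>The derivative of \<open>f u * ?K u\<close> along axis j. Its first summand
      carries z_j, so the vanishing of its integral expresses z_j times the transform by the
      transforms of \<open>f1\<close> and \<open>f2\<close>.\<close>
    define h' where "h' = (\<lambda>u. of_real s * z $ j * (f u * ?K u) - f1 u * ?K u + f2 u * ?K u)"
    have kernel_bound: "\<exists>C. \<forall>u. cmod (f u * ?K u) \<le> C * weight u" if f: "f \<in> schwartz_space" for f
    proof -
      obtain B where "\<And>u. cmod (f u) \<le> B" using schwartz_space_bounded[OF f] by blast
      then show ?thesis by (rule gauss_kernel_mult_weight_bound[where f = f, OF c])
    qed
    obtain C where C: "\<And>u. cmod (f u * ?K u) \<le> C * weight u" using kernel_bound[OF f] by blast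
    obtain C1 where C1: "\<And>u. cmod (f1 u * ?K u) \<le> C1 * weight u" using kernel_bound[OF S(1)] by blast
    obtain C2 where C2: "\<And>u. cmod (f2 u * ?K u) \<le> C2 * weight u" using kernel_bound[OF S(2)] by blast
    note cont = schwartz_space_continuous[OF f] S[THEN schwartz_space_continuous]
    have "(LINT u|lborel. h' u) = 0"
    proof (rule integral_directional_derivative_eq_0)
      show "continuous_on UNIV (\<lambda>u. f u * ?K u)" "continuous_on UNIV h'"
        unfolding h'_def by (intro continuous_intros cont)+
      show "cmod (f u * ?K u) \<le> C * weight u" for u by (rule C)
      show "cmod (h' u) \<le> (cmod (of_real s * z $ j) * C + C1 + C2) * weight u" for u
      proof -
        have "cmod (of_real s * z $ j * (f u * ?K u)) \<le> cmod (of_real s * z $ j) * (C * weight u)"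
          unfolding norm_mult[of "of_real s * z $ j"] by (intro mult_left_mono C) simp
        with C1[of u] C2[of u] show ?thesis
          unfolding h'_def distrib_right mult.assoc
          by (intro norm_triangle_le[OF add_mono] norm_triangle_le_diff[OF add_mono])
      qed
      fix u
      have "((\<lambda>r. f (u + r *\<^sub>R axis j 1) * ?K (u + r *\<^sub>R axis j 1)) has_vector_derivative
          f (u + 0 *\<^sub>R axis j 1) * ((of_real s * z $ j - of_real (c * u $ j)) * ?K u)
            + f2 u * ?K (u + 0 *\<^sub>R axis j 1)) (at 0)"
        unfolding f2_def
        by (rule has_vector_derivative_mult[OF schwartz_space_has_partial_deriv[OF f] gauss_kernel_axis_derivative])
      then show "((\<lambda>r. f (u + r *\<^sub>R axis j 1) * ?K (u + r *\<^sub>R axis j 1)) has_vector_derivative h' u) (at 0)"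
        by (simp add: h'_def f1_def algebra_simps)
    qed
    then have "of_real s * z $ j * gauss_transform c s f z - gauss_transform c s f1 z + gauss_transform c s f2 z = 0"
      unfolding h'_def gauss_transform_def using int[OF f] int[OF S(1)] int[OF S(2)] by simp
    then have "z $ j * gauss_transform c s f z = k * (gauss_transform c s f1 z - gauss_transform c s f2 z)"
      using s by (simp add: k_def field_simps add_eq_0_iff2)
    also have "\<dots> = gauss_transform c s g z"
      unfolding gauss_transform_def g_def using int[OF S(1)] int[OF S(2)] by (simp add: distrib_right left_diff_distrib mult.assoc)
    finally show ?thesis .
  qed
  ultimately show ?thesis using that by blast
qed

lemma norm_le_sum_cmod: "norm (z :: complex ^ 'n) \<le> (\<Sum>j\<in>UNIV. cmod (z $ j))"
  unfolding norm_vec_def by (rule L2_set_le_sum) simp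

text \<open>The sum of the |z_j| replaces the norm because one more factor 1 + \<Sum>|z_j| splits
  into the transform itself and the products with each z_j, all of them transforms of Schwartz
  functions. The induction therefore runs over m with f arbitrary.\<close>

lemma gauss_transform_decay:
  fixes f :: "real ^ 'n \<Rightarrow> complex"
  assumes c: "0 < c" and s: "s \<noteq> 0" and f: "f \<in> schwartz_space"
  shows "\<exists>C. \<forall>x y. (1 + (\<Sum>j\<in>UNIV. cmod (cvec x y $ j))) ^ m * cmod (gauss_transform c s f (cvec x y)) \<le>
    C * exp (s\<^sup>2 / (2 * c) * (norm x)\<^sup>2)"
  using f
proof (induction m arbitrary: f)
  case 0
  obtain B where "\<And>u. cmod (f u) \<le> B"
    using schwartz_space_bounded[OF 0] by blast
  from gauss_transform_bound[OF c schwartz_space_continuous[OF 0] this] show ?case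
    unfolding power_0 mult_1 by blast
next
  case (Suc m)
  let ?e = "\<lambda>x :: real ^ 'n. exp (s\<^sup>2 / (2 * c) * (norm x)\<^sup>2)"
  let ?p = "\<lambda>x y :: real ^ 'n. 1 + (\<Sum>j\<in>UNIV. cmod (cvec x y $ j))"
  have "\<forall>j. \<exists>g. g \<in> schwartz_space \<and> (\<forall>z. z $ j * gauss_transform c s f z = gauss_transform c s g z)"
    using gauss_transform_coord[OF c s Suc.prems] by metis
  then obtain g where g: "\<And>j. g j \<in> schwartz_space"
    "\<And>j z. z $ j * gauss_transform c s f z = gauss_transform c s (g j) z"
    by metis
  obtain C0 where C0: "\<And>x y. ?p x y ^ m * cmod (gauss_transform c s f (cvec x y)) \<le> C0 * ?e x"
    using Suc.IH[OF Suc.prems] by blast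
  obtain C where C: "\<And>j x y. ?p x y ^ m * cmod (gauss_transform c s (g j) (cvec x y)) \<le> C j * ?e x"
    using Suc.IH[OF g(1)] by metis
  have "?p x y ^ Suc m * cmod (gauss_transform c s f (cvec x y)) \<le> (C0 + (\<Sum>j\<in>UNIV. C j)) * ?e x" for x y
  proof -
    define T where "T = cmod (gauss_transform c s f (cvec x y))"
    have T: "cmod (gauss_transform c s (g j) (cvec x y)) = cmod (cvec x y $ j) * T" for j
      by (simp add: g(2)[symmetric] norm_mult T_def)
    have "?p x y ^ Suc m * T = ?p x y ^ m * T + ?p x y ^ m * T * (\<Sum>j\<in>UNIV. cmod (cvec x y $ j))"
      by (simp only: power_Suc algebra_simps mult_1)
    also have "\<dots> = ?p x y ^ m * T + (\<Sum>j\<in>UNIV. ?p x y ^ m * (cmod (cvec x y $ j) * T))"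
      by (subst sum_distrib_left) (simp only: mult_ac)
    also have "\<dots> = ?p x y ^ m * T + (\<Sum>j\<in>UNIV. ?p x y ^ m * cmod (gauss_transform c s (g j) (cvec x y)))"
      by (simp only: T)
    also have "\<dots> \<le> C0 * ?e x + (\<Sum>j\<in>UNIV. C j * ?e x)"
      unfolding T_def by (intro add_mono sum_mono C0 C)
    finally show ?thesis by (simp only: T_def distrib_right sum_distrib_right)
  qed
  then show ?case by blast
qed

lemma norm_cvec_sq: "(norm (cvec x y))\<^sup>2 = (norm x)\<^sup>2 + (norm y)\<^sup>2"
  by (simp add: norm_vec_def L2_set_def sum_nonneg cmod_power2 sum.distrib)

section \<open>The inverse transform\<close>

text \<open>The class meant to contain F(z) exp(c z^2/2), with \<kappa> = s^2/(2c). Asking for every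
  m makes it stable under multiplication by coordinates, since each such factor costs one
  power.\<close>

definition gauss_class :: "real \<Rightarrow> (complex ^ 'n \<Rightarrow> complex) set" where
  "gauss_class \<kappa> = {G. holomorphic_Cn G \<and>
     (\<forall>m. \<exists>B. \<forall>x y. cmod (G (cvec x y)) \<le> B * exp (\<kappa> * (norm x)\<^sup>2) / (1 + (norm x)\<^sup>2 + (norm y)\<^sup>2) ^ m)}"

lemma gauss_class_holomorphic: "G \<in> gauss_class \<kappa> \<Longrightarrow> holomorphic_Cn G"
  by (simp add: gauss_class_def)

lemma gauss_class_bound:
  "G \<in> gauss_class \<kappa> \<Longrightarrow>
    \<exists>B. \<forall>x y. cmod (G (cvec x y)) \<le> B * exp (\<kappa> * (norm x)\<^sup>2) / (1 + (norm x)\<^sup>2 + (norm y)\<^sup>2) ^ m"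
  by (simp add: gauss_class_def)

lemma gauss_class_coord:
  assumes "G \<in> gauss_class \<kappa>"
  shows "(\<lambda>z. z $ j * G z) \<in> gauss_class \<kappa>"
  unfolding gauss_class_def
proof (intro CollectI conjI allI)
  show "holomorphic_Cn (\<lambda>z. z $ j * G z)"
    by (intro holomorphic_Cn_mult holomorphic_Cn_nth gauss_class_holomorphic[OF assms])
  fix m
  obtain B where B: "\<And>x y. cmod (G (cvec x y)) \<le> B * exp (\<kappa> * (norm x)\<^sup>2) / (1 + (norm x)\<^sup>2 + (norm y)\<^sup>2) ^ Suc m"
    using gauss_class_bound[OF assms, of "Suc m"] by blast
  have "cmod (cvec x y $ j * G (cvec x y)) \<le> B * exp (\<kappa> * (norm x)\<^sup>2) / (1 + (norm x)\<^sup>2 + (norm y)\<^sup>2) ^ m" for x y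
  proof -
    let ?p = "1 + (norm x)\<^sup>2 + (norm y)\<^sup>2"
    have p: "0 < ?p" by (simp add: add_pos_nonneg)
    have "cmod (cvec x y $ j) \<le> norm (cvec x y)" by (rule Finite_Cartesian_Product.norm_nth_le)
    also have "\<dots> \<le> 1 + (norm (cvec x y))\<^sup>2"
      using zero_le_power2[of "norm (cvec x y) - 1"] norm_ge_zero[of "cvec x y"]
      unfolding power2_diff power_one by linarith
    finally have "cmod (cvec x y $ j) \<le> ?p"
      by (simp add: norm_cvec_sq)
    then have "cmod (cvec x y $ j * G (cvec x y)) \<le> ?p * (B * exp (\<kappa> * (norm x)\<^sup>2) / ?p ^ Suc m)"
      unfolding norm_mult using p by (intro mult_mono B) auto
    also have "\<dots> = B * exp (\<kappa> * (norm x)\<^sup>2) / ?p ^ m"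
      using p by simp
    finally show ?thesis .
  qed
  then show "\<exists>B. \<forall>x y. cmod (cvec x y $ j * G (cvec x y)) \<le> B * exp (\<kappa> * (norm x)\<^sup>2) / (1 + (norm x)\<^sup>2 + (norm y)\<^sup>2) ^ m"
    by blast
qed

text \<open>The decay of order m + \<open>CARD('n)\<close> is divided up: m powers remain for decay
  in x, and \<open>CARD('n)\<close> powers make the bound integrable in y.\<close>

lemma gauss_class_weight_bound:
  fixes G :: "complex ^ 'n \<Rightarrow> complex"
  assumes "G \<in> gauss_class \<kappa>"
  shows "\<exists>B\<ge>0. \<forall>x y. cmod (G (cvec x y)) \<le> B * exp (\<kappa> * (norm x)\<^sup>2) / (1 + (norm x)\<^sup>2) ^ m * weight y"
proof -
  obtain B where B: "\<And>x y. cmod (G (cvec x y)) \<le> B * exp (\<kappa> * (norm x)\<^sup>2) / (1 + (norm x)\<^sup>2 + (norm y)\<^sup>2) ^ (m + CARD('n))"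
    using gauss_class_bound[OF assms, of "m + CARD('n)"] by blast
  have B0: "0 \<le> B"
    using order_trans[OF norm_ge_zero B[of 0 0]] by simp
  have "cmod (G (cvec x y)) \<le> B * exp (\<kappa> * (norm x)\<^sup>2) / (1 + (norm x)\<^sup>2) ^ m * weight y" for x y
  proof -
    have "(1 + (norm x)\<^sup>2) ^ m * (1 + (norm y)\<^sup>2) ^ CARD('n) \<le>
        (1 + (norm x)\<^sup>2 + (norm y)\<^sup>2) ^ m * (1 + (norm x)\<^sup>2 + (norm y)\<^sup>2) ^ CARD('n)"
      by (intro mult_mono power_mono) auto
    then have "B * exp (\<kappa> * (norm x)\<^sup>2) / (1 + (norm x)\<^sup>2 + (norm y)\<^sup>2) ^ (m + CARD('n)) \<le>
        B * exp (\<kappa> * (norm x)\<^sup>2) / ((1 + (norm x)\<^sup>2) ^ m * (1 + (norm y)\<^sup>2) ^ CARD('n))"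
      using B0 unfolding power_add
      by (intro divide_left_mono mult_nonneg_nonneg mult_pos_pos zero_less_power) (auto simp: add_pos_nonneg)
    then show ?thesis
      using order_trans[OF B] by (simp add: weight_def)
  qed
  with B0 show ?thesis by blast
qed

definition imag_fourier :: "real \<Rightarrow> (complex ^ 'n \<Rightarrow> complex) \<Rightarrow> real ^ 'n \<Rightarrow> complex" where
  "imag_fourier s G u = (LINT y|lborel. G (cvec 0 y) * cis (- (s * (y \<bullet> u))))"

lemma integrable_imag_fourier:
  assumes "G \<in> gauss_class \<kappa>"
  shows "integrable lborel (\<lambda>y. G (cvec x y) * cis (- (s * (y \<bullet> u))))"
proof -
  obtain B where "\<And>x y. cmod (G (cvec x y)) \<le> B * exp (\<kappa> * (norm x)\<^sup>2) / (1 + (norm x)\<^sup>2) ^ 0 * weight y"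
    using gauss_class_weight_bound[OF assms, of 0] by blast
  then have "cmod (G (cvec x y) * cis (- (s * (y \<bullet> u)))) \<le> (B * exp (\<kappa> * (norm x)\<^sup>2)) * weight y" for y
    by (simp add: norm_mult)
  then show ?thesis
    by (rule integrable_weight_bound[rotated])
      (intro borel_measurable_continuous_UNIV continuous_intros gauss_class_holomorphic[OF assms])
qed

text \<open>The phase is the restriction to imaginary vectors of the entire function exp(-s z.u),
  which has modulus exp(-s x.u) on real part x. Shifting the contour for its product with G produces
  the exponential factor.\<close>

lemma imag_fourier_shift:
  fixes G :: "complex ^ 'n \<Rightarrow> complex"
  assumes G: "G \<in> gauss_class \<kappa>" and \<kappa>: "0 \<le> \<kappa>"
  shows "(LINT y|lborel. G (cvec x y) * cis (- (s * (y \<bullet> u)))) = of_real (exp (s * (x \<bullet> u))) * imag_fourier s G u"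
proof -
  define P where "P = (\<lambda>z. G z * exp (- of_real s * scalar_product z (of_real_vec u)))"
  have P: "P (cvec x y) = of_real (exp (- (s * (x \<bullet> u)))) * (G (cvec x y) * cis (- (s * (y \<bullet> u))))" for x y
  proof -
    have "- of_real s * scalar_product (cvec x y) (of_real_vec u) =
        of_real (- (s * (x \<bullet> u))) + \<i> * of_real (- (s * (y \<bullet> u)))"
      by (simp add: scalar_product_cvec complex_eq_iff)
    then show ?thesis
      by (simp only: P_def exp_add cis_conv_exp of_real_exp mult_ac)
  qed
  obtain B where B: "0 \<le> B" "\<And>x y. cmod (G (cvec x y)) \<le> B * exp (\<kappa> * (norm x)\<^sup>2) / (1 + (norm x)\<^sup>2) ^ 0 * weight y"
    using gauss_class_weight_bound[OF G, of 0] by blast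
  have "(LINT y|lborel. P (cvec x y)) = (LINT y|lborel. P (cvec 0 y))"
  proof (rule integral_cvec_shift)
    show "holomorphic_Cn P"
      unfolding P_def
      by (intro holomorphic_Cn_mult holomorphic_Cn_exp holomorphic_Cn_scalar_product gauss_class_holomorphic[OF G])
    fix R
    have "cmod (P (cvec x y)) \<le> (exp (\<bar>s\<bar> * (R * norm u)) * (B * exp (\<kappa> * R\<^sup>2))) * weight y"
      if x: "norm x \<le> R" for x y
    proof -
      have "- (s * (x \<bullet> u)) \<le> \<bar>s\<bar> * \<bar>x \<bullet> u\<bar>"
        using abs_ge_minus_self[of "s * (x \<bullet> u)"] by (simp add: abs_mult)
      also have "\<dots> \<le> \<bar>s\<bar> * (norm x * norm u)"
        by (intro mult_left_mono Cauchy_Schwarz_ineq2) simp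
      also have "\<dots> \<le> \<bar>s\<bar> * (R * norm u)"
        using x by (intro mult_left_mono mult_right_mono) auto
      finally have "cmod (P (cvec x y)) \<le> exp (\<bar>s\<bar> * (R * norm u)) * cmod (G (cvec x y))"
        by (simp add: P norm_mult mult_right_mono)
      also have "cmod (G (cvec x y)) \<le> B * exp (\<kappa> * (norm x)\<^sup>2) * weight y"
        using B(2)[of x y] by simp
      also have "B * exp (\<kappa> * (norm x)\<^sup>2) * weight y \<le> B * exp (\<kappa> * R\<^sup>2) * weight y"
      proof -
        have "\<kappa> * (norm x)\<^sup>2 \<le> \<kappa> * R\<^sup>2"
          using x \<kappa> by (intro mult_left_mono power_mono) auto
        then show ?thesis using B(1)
          by (intro mult_left_mono mult_right_mono) (auto simp: weight_pos less_imp_le)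
      qed
      finally show ?thesis by (simp add: mult.assoc)
    qed
    then show "\<exists>M. \<forall>x y. norm x \<le> R \<longrightarrow> cmod (P (cvec x y)) \<le> M * weight y" by blast
  qed
  then have shift: "of_real (exp (- (s * (x \<bullet> u)))) * (LINT y|lborel. G (cvec x y) * cis (- (s * (y \<bullet> u)))) = imag_fourier s G u"
    by (simp add: P imag_fourier_def)
  have "complex_of_real (exp (s * (x \<bullet> u))) * of_real (exp (- (s * (x \<bullet> u)))) = 1"
    by (simp only: of_real_mult[symmetric] exp_add[symmetric]) simp
  then show ?thesis
    unfolding shift[symmetric] mult.assoc[symmetric] by simp
qed

text \<open>The contour is moved to real part \<open>(c/s) u\<close>, where the integrand is smallest.\<close>

lemma imag_fourier_bound:
  fixes G :: "complex ^ 'n \<Rightarrow> complex"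
  assumes s: "0 < s" "s \<le> c" and G: "G \<in> gauss_class (s\<^sup>2 / (2 * c))"
  shows "\<exists>C\<ge>0. \<forall>u. cmod (imag_fourier s G u) \<le> C * exp (- (c / 2) * (norm u)\<^sup>2) / (1 + (norm u)\<^sup>2) ^ m"
proof -
  define W where "W = (LINT y|lborel. weight (y :: real ^ 'n))"
  have W: "0 \<le> W" unfolding W_def by (intro integral_nonneg_AE AE_I2) (simp add: weight_pos less_imp_le)
  have c: "0 < c" using s by simp
  obtain B where B: "0 \<le> B" "\<And>x y. cmod (G (cvec x y)) \<le> B * exp (s\<^sup>2 / (2 * c) * (norm x)\<^sup>2) / (1 + (norm x)\<^sup>2) ^ m * weight y"
    using gauss_class_weight_bound[OF G, of m] by blast
  have "cmod (imag_fourier s G u) \<le> B * W * exp (- (c / 2) * (norm u)\<^sup>2) / (1 + (norm u)\<^sup>2) ^ m" for u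
  proof -
    \<comment> \<open>The shift gains exp(-c |u|^2) and the growth of G costs only exp(c |u|^2/2).
      The condition \<open>s \<le> c\<close> gives \<open>norm u \<le> norm x\<close>, so decay in x
      passes to decay in u.\<close>
    define x where "x = (c / s) *\<^sub>R u"
    have xu: "s * (x \<bullet> u) = c * (norm u)\<^sup>2"
      using s by (simp add: x_def power2_norm_eq_inner)
    have xx: "s\<^sup>2 / (2 * c) * (norm x)\<^sup>2 = (c / 2) * (norm u)\<^sup>2"
      using s c by (simp add: x_def power_mult_distrib power2_eq_square field_simps)
    have ux: "norm u \<le> norm x"
      using s by (simp add: x_def le_divide_eq mult.commute[of "norm u"] mult_right_mono)
    have "exp (c * (norm u)\<^sup>2) * cmod (imag_fourier s G u) =
        cmod (LINT y|lborel. G (cvec x y) * cis (- (s * (y \<bullet> u))))"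
      using s c by (subst imag_fourier_shift[OF G]) (simp_all add: norm_mult xu)
    also have "\<dots> \<le> B * exp (s\<^sup>2 / (2 * c) * (norm x)\<^sup>2) / (1 + (norm x)\<^sup>2) ^ m * W"
      unfolding W_def
    proof (rule integral_weight_bound)
      show "cmod (G (cvec x y) * cis (- (s * (y \<bullet> u)))) \<le> B * exp (s\<^sup>2 / (2 * c) * (norm x)\<^sup>2) / (1 + (norm x)\<^sup>2) ^ m * weight y" for y
        using B(2)[of x y] by (simp add: norm_mult)
    qed (intro borel_measurable_continuous_UNIV continuous_intros gauss_class_holomorphic[OF G])
    also have "\<dots> = B * W * exp ((c / 2) * (norm u)\<^sup>2) / (1 + (norm x)\<^sup>2) ^ m"
      unfolding xx by (simp add: mult_ac)
    also have "\<dots> \<le> B * W * exp ((c / 2) * (norm u)\<^sup>2) / (1 + (norm u)\<^sup>2) ^ m"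
      using ux B W by (intro divide_left_mono power_mono add_left_mono mult_pos_pos zero_less_power) (auto simp: add_pos_nonneg)
    finally have "exp (- (c * (norm u)\<^sup>2)) * (exp (c * (norm u)\<^sup>2) * cmod (imag_fourier s G u)) \<le>
        exp (- (c * (norm u)\<^sup>2)) * (B * W * exp ((c / 2) * (norm u)\<^sup>2) / (1 + (norm u)\<^sup>2) ^ m)"
      by (intro mult_left_mono) auto
    also have "exp (- (c * (norm u)\<^sup>2)) * (exp (c * (norm u)\<^sup>2) * cmod (imag_fourier s G u)) = cmod (imag_fourier s G u)"
      by (simp add: exp_minus)
    also have "exp (- (c * (norm u)\<^sup>2)) * (B * W * exp ((c / 2) * (norm u)\<^sup>2) / (1 + (norm u)\<^sup>2) ^ m) =
        B * W * (exp (- (c * (norm u)\<^sup>2)) * exp ((c / 2) * (norm u)\<^sup>2)) / (1 + (norm u)\<^sup>2) ^ m"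
      by simp
    also have "exp (- (c * (norm u)\<^sup>2)) * exp ((c / 2) * (norm u)\<^sup>2) = exp (- (c / 2) * (norm u)\<^sup>2)"
      unfolding exp_add[symmetric] by (rule arg_cong[of _ _ exp]) (simp add: field_simps)
    finally show ?thesis .
  qed
  moreover have "0 \<le> B * W" using B W by simp
  ultimately show ?thesis by blast
qed

section \<open>Regularity of the Fourier integral and the Schwartz property\<close>

lemma continuous_on_imag_fourier:
  assumes G: "G \<in> gauss_class \<kappa>"
  shows "continuous_on UNIV (imag_fourier s G)"
  unfolding continuous_on_sequentially comp_def
proof (intro allI ballI impI, elim conjE)
  fix x :: "nat \<Rightarrow> real ^ 'a" and u
  assume x: "x \<longlonglongrightarrow> u"
  show "(\<lambda>k. imag_fourier s G (x k)) \<longlonglongrightarrow> imag_fourier s G u"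
    unfolding imag_fourier_def
  proof (rule integral_dominated_convergence)
    show "integrable lborel (\<lambda>y. cmod (G (cvec 0 y) * cis (- (s * (y \<bullet> 0)))))"
      by (intro integrable_norm integrable_imag_fourier[OF G])
    show "AE y in lborel. cmod (G (cvec 0 y) * cis (- (s * (y \<bullet> x k)))) \<le> cmod (G (cvec 0 y) * cis (- (s * (y \<bullet> 0))))" for k
      by (simp add: norm_mult)
    have "(\<lambda>k. G (cvec 0 y) * cis (- (s * (y \<bullet> x k)))) \<longlonglongrightarrow> G (cvec 0 y) * cis (- (s * (y \<bullet> u)))" for y
      unfolding cis_conv_exp by (intro tendsto_intros x)
    then show "AE y in lborel. (\<lambda>k. G (cvec 0 y) * cis (- (s * (y \<bullet> x k)))) \<longlonglongrightarrow> G (cvec 0 y) * cis (- (s * (y \<bullet> u)))"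
      by simp
  qed (intro borel_measurable_continuous_UNIV continuous_intros gauss_class_holomorphic[OF G])+
qed

lemma cis_second_order_bound: "cmod (cis \<theta> - 1 - \<i> * of_real \<theta>) \<le> \<theta>\<^sup>2"
  using Taylor_exp[of "\<i> * of_real \<theta>" 1] by (simp add: cis_conv_exp norm_mult power2_eq_square diff_diff_eq)

text \<open>Differentiating the phase brings down -\<i> s y_j, and \<i> y_j is the coordinate z_j on
  imaginary vectors; hence the real factor -s and the function z_j G. The second-order error of the
  phase costs y_j^2, which is integrable because z_j^2 G is again in the class.\<close>

lemma imag_fourier_axis_derivative:
  fixes G :: "complex ^ 'n \<Rightarrow> complex"
  assumes G: "G \<in> gauss_class \<kappa>"
  shows "((\<lambda>r. imag_fourier s G (u + r *\<^sub>R axis j 1)) has_vector_derivative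
      - of_real s * imag_fourier s (\<lambda>z. z $ j * G z) u) (at 0)"
proof -
  define G1 where "G1 = (\<lambda>z. z $ j * G z)"
  define G2 where "G2 = (\<lambda>z. z $ j * G1 z)"
  have G1: "G1 \<in> gauss_class \<kappa>" and G2: "G2 \<in> gauss_class \<kappa>"
    unfolding G2_def G1_def by (intro gauss_class_coord G)+
  define Q where "Q = (\<lambda>H y. H (cvec 0 y) * cis (- (s * (y \<bullet> u))))" for H :: "complex ^ 'n \<Rightarrow> complex"
  have intQ: "integrable lborel (Q H)" if "H \<in> gauss_class \<kappa>" for H
    unfolding Q_def by (rule integrable_imag_fourier[OF that])
  have FQ: "imag_fourier s H u = (LINT y|lborel. Q H y)" for H
    by (simp add: imag_fourier_def Q_def)
  show ?thesis
  proof (rule has_vector_derivative_of_quadratic)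
    fix r :: real
    let ?Q' = "\<lambda>y. G (cvec 0 y) * cis (- (s * (y \<bullet> (u + r *\<^sub>R axis j 1))))"
    have int': "integrable lborel ?Q'"
      by (rule integrable_imag_fourier[OF G])
    have eq: "imag_fourier s G (u + (0 + r) *\<^sub>R axis j 1) - imag_fourier s G (u + 0 *\<^sub>R axis j 1)
        - r *\<^sub>R (- of_real s * imag_fourier s (\<lambda>z. z $ j * G z) u)
        = (LINT y|lborel. ?Q' y - Q G y + of_real (r * s) * Q G1 y)"
      using int' intQ[OF G] intQ[OF G1]
      by (simp add: FQ G1_def[symmetric] scaleR_conv_of_real) (simp add: imag_fourier_def)
    have "norm (LINT y|lborel. ?Q' y - Q G y + of_real (r * s) * Q G1 y) \<le>
        (LINT y|lborel. (s * r)\<^sup>2 * norm (Q G2 y))"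
    proof (rule Bochner_Integration.integral_norm_bound_integral)
      show "integrable lborel (\<lambda>y. ?Q' y - Q G y + of_real (r * s) * Q G1 y)"
        using int' intQ[OF G] intQ[OF G1] by simp
      show "integrable lborel (\<lambda>y. (s * r)\<^sup>2 * norm (Q G2 y))"
        using intQ[OF G2] by simp
      fix y :: "real ^ 'n"
      define \<theta> where "\<theta> = - (s * (r * y $ j))"
      have "- (s * (y \<bullet> (u + r *\<^sub>R axis j 1))) = - (s * (y \<bullet> u)) + \<theta>"
        by (simp add: \<theta>_def inner_add_right inner_axis algebra_simps)
      then have "?Q' y = Q G y * cis \<theta>"
        by (simp only: Q_def mult.assoc cis_mult)
      moreover have "of_real (r * s) * Q G1 y = - (Q G y * (\<i> * of_real \<theta>))"
        by (simp add: Q_def G1_def \<theta>_def Complex_eq mult_ac)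
      ultimately have "?Q' y - Q G y + of_real (r * s) * Q G1 y =
          Q G y * (cis \<theta> - 1 - \<i> * of_real \<theta>)"
        by (simp only:) (simp add: right_diff_distrib)
      then have "norm (?Q' y - Q G y + of_real (r * s) * Q G1 y) \<le> norm (Q G y) * \<theta>\<^sup>2"
        by (simp add: norm_mult mult_left_mono cis_second_order_bound)
      also have "\<dots> = (s * r)\<^sup>2 * norm (Q G2 y)"
        by (simp add: \<theta>_def Q_def G2_def G1_def norm_mult power2_eq_square Complex_eq)
      finally show "norm (?Q' y - Q G y + of_real (r * s) * Q G1 y) \<le> (s * r)\<^sup>2 * norm (Q G2 y)" .
    qed
    then show "norm (imag_fourier s G (u + (0 + r) *\<^sub>R axis j 1) - imag_fourier s G (u + 0 *\<^sub>R axis j 1)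
        - r *\<^sub>R (- of_real s * imag_fourier s (\<lambda>z. z $ j * G z) u)) \<le>
        (s\<^sup>2 * (LINT y|lborel. norm (Q G2 y))) * r\<^sup>2"
      unfolding eq by (simp add: power_mult_distrib mult_ac)
  qed
qed

definition inverse_gauss :: "real \<Rightarrow> real \<Rightarrow> (complex ^ 'n \<Rightarrow> complex) \<Rightarrow> real ^ 'n \<Rightarrow> complex" where
  "inverse_gauss c s G u = of_real (exp ((c / 2) * (norm u)\<^sup>2)) * imag_fourier s G u"

text \<open>Writing the growing Gaussian as a kernel with parameters -c and 0 lets
  \<open>gauss_kernel_axis_derivative\<close> differentiate it.\<close>

lemma inverse_gauss_conv_kernel:
  "inverse_gauss c s G u = gauss_kernel (- c) 0 0 u * imag_fourier s G u"
  by (simp only: inverse_gauss_def gauss_kernel_def exp_of_real[symmetric]) simp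

lemma prod_power_le:
  "\<bar>\<Prod>j\<in>UNIV. (u $ j) ^ \<alpha> j\<bar> \<le> (1 + (norm (u :: real ^ 'n))\<^sup>2) ^ (\<Sum>j\<in>UNIV. \<alpha> j)"
proof -
  have u: "\<bar>u $ j\<bar> \<le> 1 + (norm u)\<^sup>2" for j
  proof -
    have "\<bar>u $ j\<bar> \<le> norm u" by (rule component_le_norm_cart)
    then show ?thesis
      using zero_le_power2[of "norm u - 1"] norm_ge_zero[of u]
      unfolding power2_diff power_one by linarith
  qed
  have "\<bar>\<Prod>j\<in>UNIV. (u $ j) ^ \<alpha> j\<bar> = (\<Prod>j\<in>UNIV. \<bar>u $ j\<bar> ^ \<alpha> j)"
    by (simp add: abs_prod power_abs)
  also have "\<dots> \<le> (\<Prod>j\<in>UNIV. (1 + (norm u)\<^sup>2) ^ \<alpha> j)"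
    by (intro prod_mono conjI power_mono u) auto
  finally show ?thesis by (simp add: power_sum)
qed

lemma inverse_gauss_schwartz:
  fixes G :: "complex ^ 'n \<Rightarrow> complex"
  assumes s: "0 < s" "s \<le> c" and G: "G \<in> gauss_class (s\<^sup>2 / (2 * c))"
  shows "inverse_gauss c s G \<in> schwartz_space"
proof -
  \<comment> \<open>The generators come from the whole class, since the derivative of the function
    belonging to G involves the one belonging to z_j G.\<close>
  define S where "S = inverse_gauss c s ` (gauss_class (s\<^sup>2 / (2 * c)) :: (complex ^ 'n \<Rightarrow> complex) set)"
  have "poly_span S \<subseteq> schwartz_space"
  proof (rule poly_span_subset_schwartz_space)
    fix f assume "f \<in> S"
    then obtain G :: "complex ^ 'n \<Rightarrow> complex" where G: "G \<in> gauss_class (s\<^sup>2 / (2 * c))" and f: "f = inverse_gauss c s G"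
      by (auto simp: S_def)
    show "continuous_on UNIV f"
      unfolding f inverse_gauss_def by (intro continuous_intros continuous_on_imag_fourier[OF G])
    show "\<exists>C. \<forall>x. cmod (complex_of_real (\<Prod>j\<in>UNIV. (x $ j) ^ \<alpha> j) * f x) \<le> C" for \<alpha>
    proof -
      let ?m = "\<Sum>j\<in>UNIV. \<alpha> j"
      obtain C where C: "\<And>u. cmod (imag_fourier s G u) \<le> C * exp (- (c / 2) * (norm u)\<^sup>2) / (1 + (norm u)\<^sup>2) ^ ?m"
        using imag_fourier_bound[OF s G, of ?m] by blast
      have "cmod (complex_of_real (\<Prod>j\<in>UNIV. (x $ j) ^ \<alpha> j) * f x) \<le> C" for x
      proof -
        let ?p = "(1 + (norm x)\<^sup>2) ^ ?m"
        have p: "0 < ?p" by (intro zero_less_power) (simp add: add_pos_nonneg)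
        \<comment> \<open>The two Gaussians cancel exactly, leaving the polynomial decay chosen to
          match the degree of the monomial.\<close>
        have "cmod (f x) \<le> exp ((c / 2) * (norm x)\<^sup>2) * (C * exp (- (c / 2) * (norm x)\<^sup>2) / ?p)"
          unfolding f inverse_gauss_def norm_mult norm_of_real
          by (intro mult_mono C) auto
        also have "\<dots> = C / ?p" by (simp add: exp_minus)
        finally have "cmod (complex_of_real (\<Prod>j\<in>UNIV. (x $ j) ^ \<alpha> j) * f x) \<le> ?p * (C / ?p)"
          unfolding norm_mult norm_of_real using p by (intro mult_mono prod_power_le) auto
        then show ?thesis
          by (simp only: times_divide_eq_right nonzero_mult_div_cancel_left[OF less_imp_neq[OF p, symmetric]])
      qed
      then show ?thesis by blast
    qed
    show "\<exists>g\<in>poly_span S. \<forall>x. ((\<lambda>r. f (x + r *\<^sub>R axis j 1)) has_vector_derivative g x) (at 0)" for j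
    proof (intro bexI allI)
      let ?G1 = "\<lambda>z. z $ j * G z"
      let ?g = "\<lambda>u. of_real c * (of_real (u $ j) * inverse_gauss c s G u) + (- of_real s) * inverse_gauss c s ?G1 u"
      have "inverse_gauss c s G \<in> S" "inverse_gauss c s ?G1 \<in> S"
        using G gauss_class_coord[OF G] unfolding S_def by blast+
      then show "?g \<in> poly_span S"
        by (intro poly_span.add poly_span.scale poly_span.coord poly_span.base)
      fix u
      have "((\<lambda>r. gauss_kernel (- c) 0 0 (u + r *\<^sub>R axis j 1) * imag_fourier s G (u + r *\<^sub>R axis j 1)) has_vector_derivative
          gauss_kernel (- c) 0 0 (u + 0 *\<^sub>R axis j 1) * (- of_real s * imag_fourier s ?G1 u) +
          ((of_real 0 * (0 :: complex ^ 'n) $ j - of_real (- c * u $ j)) * gauss_kernel (- c) 0 0 u) * imag_fourier s G (u + 0 *\<^sub>R axis j 1)) (at 0)"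
        by (rule has_vector_derivative_mult[OF gauss_kernel_axis_derivative imag_fourier_axis_derivative[OF G]])
      then show "((\<lambda>r. f (u + r *\<^sub>R axis j 1)) has_vector_derivative ?g u) (at 0)"
        unfolding f inverse_gauss_conv_kernel by (simp add: algebra_simps)
    qed
  qed
  moreover have "inverse_gauss c s G \<in> poly_span S"
    using G by (auto simp: S_def intro: poly_span.base)
  ultimately show ?thesis by blast
qed

lemma gauss_transform_inverse_gauss:
  fixes s :: real
  assumes s: "0 < s" "s \<le> c"
  shows "\<exists>K::real. 0 < K \<and> (\<forall>G\<in>gauss_class (s\<^sup>2 / (2 * c)). \<forall>z :: complex ^ 'n.
       gauss_transform c s (inverse_gauss c s G) z = of_real K * G z)"
proof (rule fourier_inversion[OF s(1), where 'n = 'n])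
  have c: "0 < c" using s by simp
  fix K :: real
  assume K: "0 < K"
    and inv: "\<And>(h :: real ^ 'n \<Rightarrow> complex) M M' y.
      \<lbrakk>continuous_on UNIV h; \<And>\<eta>. cmod (h \<eta>) \<le> M * weight \<eta>;
       continuous_on UNIV (\<lambda>u. LINT \<eta>|lborel. h \<eta> * cis (- (s * (\<eta> \<bullet> u))));
       \<And>u. cmod (LINT \<eta>|lborel. h \<eta> * cis (- (s * (\<eta> \<bullet> u)))) \<le> M' * weight u\<rbrakk> \<Longrightarrow>
      (LINT u|lborel. (LINT \<eta>|lborel. h \<eta> * cis (- (s * (\<eta> \<bullet> u)))) * cis (s * (y \<bullet> u))) = of_real K * h y"
  have "gauss_transform c s (inverse_gauss c s G) z = of_real K * G z"
    if G: "G \<in> gauss_class (s\<^sup>2 / (2 * c))" for G :: "complex ^ 'n \<Rightarrow> complex" and z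
  proof -
    obtain x y where z: "z = cvec x y" using cvec_Re_Im by blast
    have shift: "(LINT \<eta>|lborel. G (cvec x \<eta>) * cis (- (s * (\<eta> \<bullet> u)))) = of_real (exp (s * (x \<bullet> u))) * imag_fourier s G u" for u
      using c by (intro imag_fourier_shift[OF G]) simp
    obtain B where B: "\<And>x y. cmod (G (cvec x y)) \<le> B * exp (s\<^sup>2 / (2 * c) * (norm x)\<^sup>2) / (1 + (norm x)\<^sup>2) ^ 0 * weight y"
      using gauss_class_weight_bound[OF G, of 0] by blast
    obtain C where C: "0 \<le> C" "\<And>u. cmod (imag_fourier s G u) \<le> C * exp (- (c / 2) * (norm u)\<^sup>2) / (1 + (norm u)\<^sup>2) ^ 0"
      using imag_fourier_bound[OF s G, of 0] by blast
    obtain C' where C': "\<And>u. exp (- (c / 2) * (norm u)\<^sup>2 + (s *\<^sub>R x) \<bullet> u) \<le> C' * weight u"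
      using gaussian_linear_weight_bound[of "c / 2" "s *\<^sub>R x"] c by auto
    have "(LINT u|lborel. (LINT \<eta>|lborel. G (cvec x \<eta>) * cis (- (s * (\<eta> \<bullet> u)))) * cis (s * (y \<bullet> u))) = of_real K * G (cvec x y)"
    proof (rule inv)
      show "continuous_on UNIV (\<lambda>\<eta>. G (cvec x \<eta>))"
        by (intro continuous_intros gauss_class_holomorphic[OF G])
      show "cmod (G (cvec x \<eta>)) \<le> (B * exp (s\<^sup>2 / (2 * c) * (norm x)\<^sup>2)) * weight \<eta>" for \<eta>
        using B[of x \<eta>] by simp
      show "continuous_on UNIV (\<lambda>u. LINT \<eta>|lborel. G (cvec x \<eta>) * cis (- (s * (\<eta> \<bullet> u))))"
        unfolding shift by (intro continuous_intros continuous_on_imag_fourier[OF G])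
      \<comment> \<open>The shift introduces the unbounded factor exp(s x.u), which the Gaussian
        decay of \<open>imag_fourier\<close> absorbs for fixed x. This is the decay on the frequency
        side that inversion requires.\<close>
      show "cmod (LINT \<eta>|lborel. G (cvec x \<eta>) * cis (- (s * (\<eta> \<bullet> u)))) \<le> (C * C') * weight u" for u
      proof -
        have "cmod (LINT \<eta>|lborel. G (cvec x \<eta>) * cis (- (s * (\<eta> \<bullet> u)))) \<le>
            exp (s * (x \<bullet> u)) * (C * exp (- (c / 2) * (norm u)\<^sup>2))"
          unfolding shift norm_mult norm_of_real using C(2)[of u] by (intro mult_mono) auto
        also have "\<dots> = C * exp (- (c / 2) * (norm u)\<^sup>2 + (s *\<^sub>R x) \<bullet> u)"
          unfolding exp_add by simp
        also have "\<dots> \<le> C * (C' * weight u)"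
          by (intro mult_left_mono C' C)
        finally show ?thesis by simp
      qed
    qed
    \<comment> \<open>The growing Gaussian cancels the one in the kernel. The remaining factor exp(s
      x.u) is the shift factor, so only the Fourier transform of the slice at real part x and the
      inverse phase at y are left.\<close>
    moreover have "inverse_gauss c s G u * gauss_kernel c s (cvec x y) u =
        (LINT \<eta>|lborel. G (cvec x \<eta>) * cis (- (s * (\<eta> \<bullet> u)))) * cis (s * (y \<bullet> u))" for u
    proof -
      have "of_real (exp ((c / 2) * (norm u)\<^sup>2)) * gauss_kernel c s (cvec x y) u =
          exp (of_real ((c / 2) * (norm u)\<^sup>2) + (of_real (- (c / 2) * (norm u)\<^sup>2) + of_real s * Complex (x \<bullet> u) (y \<bullet> u)))"
        by (simp only: gauss_kernel_def scalar_product_cvec exp_of_real[symmetric] exp_add)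
      also have "of_real ((c / 2) * (norm u)\<^sup>2) + (of_real (- (c / 2) * (norm u)\<^sup>2) + of_real s * Complex (x \<bullet> u) (y \<bullet> u))
          = of_real (s * (x \<bullet> u)) + \<i> * of_real (s * (y \<bullet> u))"
        by (simp add: complex_eq_iff)
      finally have "of_real (exp ((c / 2) * (norm u)\<^sup>2)) * gauss_kernel c s (cvec x y) u =
          of_real (exp (s * (x \<bullet> u))) * cis (s * (y \<bullet> u))"
        by (simp only: exp_add cis_conv_exp exp_of_real[symmetric])
      then show ?thesis
        unfolding shift inverse_gauss_def by (metis mult.assoc mult.commute)
    qed
    ultimately show ?thesis by (simp add: gauss_transform_def z)
  qed
  with K show ?thesis by blast
qed

section \<open>The Hermite semigroup and the equivalence\<close>

lemma hermite_semigroup_conv_gauss_transform: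
  assumes t: "0 < t"
  shows "\<exists>C0::real. 0 < C0 \<and> (\<forall>(f :: real ^ 'n \<Rightarrow> complex) z. hermite_semigroup t f z =
      of_real C0 * exp (- (of_real (coth (2 * t)) / 2) * vec_sq z) * gauss_transform (coth (2 * t)) (1 / sinh (2 * t)) f z)"
proof -
  define C0 where "C0 = (2 * pi) powr (- real CARD('n) / 2) * sinh (2 * t) powr (- real CARD('n) / 2)"
  have "0 < sinh (2 * t)" using t by simp
  then have "0 < C0" by (simp add: C0_def)
  moreover have "hermite_semigroup t f z =
      of_real C0 * exp (- (of_real (coth (2 * t)) / 2) * vec_sq z) * gauss_transform (coth (2 * t)) (1 / sinh (2 * t)) f z"
    for f :: "real ^ 'n \<Rightarrow> complex" and z
  proof -
    have "mehler_kernel t z u = of_real C0 * exp (- (of_real (coth (2 * t)) / 2) * vec_sq z) *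
        gauss_kernel (coth (2 * t)) (1 / sinh (2 * t)) z u" for u
    proof -
      have "- (1 / 2) * complex_of_real (coth (2 * t)) * (vec_sq z + complex_of_real (vec_sq u))
          + complex_of_real (1 / sinh (2 * t)) * scalar_product z (of_real_vec u) =
          - (of_real (coth (2 * t)) / 2) * vec_sq z + (of_real (- (coth (2 * t) / 2) * (norm u)\<^sup>2)
          + of_real (1 / sinh (2 * t)) * scalar_product z (of_real_vec u))"
        by (simp add: vec_sq_real algebra_simps)
      then show ?thesis
        by (simp only: mehler_kernel_def gauss_kernel_def C0_def exp_add mult.assoc)
    qed
    then have "hermite_semigroup t f z = (LINT u|lborel. (of_real C0 * exp (- (of_real (coth (2 * t)) / 2) * vec_sq z)) *
        (f u * gauss_kernel (coth (2 * t)) (1 / sinh (2 * t)) z u))"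
      unfolding hermite_semigroup_def by (simp only: mult_ac)
    then show ?thesis
      by (simp add: gauss_transform_def)
  qed
  ultimately show ?thesis by blast
qed

lemma norm_exp_vec_sq: "cmod (exp (of_real a * vec_sq (cvec x y))) = exp (a * ((norm x)\<^sup>2 - (norm y)\<^sup>2))"
  by (simp add: vec_sq_cvec)

theorem theorem4p2:
  fixes F :: "complex ^ 'n \<Rightarrow> complex" and t :: real
  assumes "t > 0" and "holomorphic_Cn F"
  shows "(\<exists>f \<in> schwartz_space. F = hermite_semigroup t f) \<longleftrightarrow>
    (\<exists>A :: nat \<Rightarrow> real. \<forall>m\<ge>1. \<forall>x y :: real ^ 'n.
       (cmod (F (cvec x y)))\<^sup>2 \<le>
         A m * (exp (- tanh (2 * t) * vec_sq x + coth (2 * t) * vec_sq y)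
                / (1 + vec_sq x + vec_sq y) ^ (2 * m)))"
proof -
  define c where "c = coth (2 * t)"
  define s where "s = 1 / sinh (2 * t)"
  define \<kappa> where "\<kappa> = s\<^sup>2 / (2 * c)"
  have sh: "0 < sinh (2 * t)" and ch: "1 \<le> cosh (2 * t)"
    using assms(1) by (simp_all add: cosh_real_ge_1)
  have s: "0 < s" "s \<le> c"
    using sh ch by (simp_all add: s_def c_def coth_def divide_right_mono)
  then have c: "0 < c" by simp
  have cs: "c\<^sup>2 = 1 + s\<^sup>2"
    using sh cosh_square_eq[of "2 * t"] by (simp add: c_def s_def coth_def field_simps power_divide)
  have tanh: "tanh (2 * t) = 1 / c"
    by (simp add: c_def coth_def tanh_def)
  have \<kappa>: "2 * \<kappa> = c - 1 / c"
    using c cs by (simp add: \<kappa>_def field_simps power2_eq_square)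
  obtain C0 where C0: "0 < C0" and H: "\<And>(f :: real ^ 'n \<Rightarrow> complex) z. hermite_semigroup t f z =
      of_real C0 * exp (- (of_real c / 2) * vec_sq z) * gauss_transform c s f z"
    using hermite_semigroup_conv_gauss_transform[OF assms(1), where 'n = 'n] unfolding c_def s_def by blast
  let ?p = "\<lambda>x y :: real ^ 'n. 1 + (norm x)\<^sup>2 + (norm y)\<^sup>2"
  have p: "1 \<le> ?p x y" for x y by simp
  show ?thesis
    unfolding vec_sq_real tanh c_def[symmetric]
  proof
    assume "\<exists>f \<in> schwartz_space. F = hermite_semigroup t f"
    then obtain f where f: "f \<in> schwartz_space" "F = hermite_semigroup t f" by blast
    have "\<exists>A. \<forall>x y. (cmod (F (cvec x y)))\<^sup>2 \<le> A * (exp (- (1 / c) * (norm x)\<^sup>2 + c * (norm y)\<^sup>2) / ?p x y ^ (2 * m))" for m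
    proof -
      \<comment> \<open>Order 2m in 1 + \<Sum>|z_j| yields order m in \<open>?p\<close>, because
        \<open>?p\<close> is at most the square of that sum; squaring the modulus then yields the
        power 2m.\<close>
      obtain C where C: "\<And>x y. (1 + (\<Sum>j\<in>UNIV. cmod (cvec x y $ j))) ^ (2 * m) * cmod (gauss_transform c s f (cvec x y)) \<le> C * exp (\<kappa> * (norm x)\<^sup>2)"
        using gauss_transform_decay[OF c _ f(1), of s "2 * m"] s unfolding \<kappa>_def by blast
      have "(cmod (F (cvec x y)))\<^sup>2 \<le> (C0 * C)\<^sup>2 * (exp (- (1 / c) * (norm x)\<^sup>2 + c * (norm y)\<^sup>2) / ?p x y ^ (2 * m))" for x y
      proof -
        let ?T = "cmod (gauss_transform c s f (cvec x y))"
        let ?S = "\<Sum>j\<in>UNIV. cmod (cvec x y $ j)"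
        have "?p x y = 1 + (norm (cvec x y))\<^sup>2" by (simp add: norm_cvec_sq)
        also have "\<dots> \<le> (1 + norm (cvec x y))\<^sup>2" by (simp add: power2_sum)
        also have "\<dots> \<le> (1 + ?S)\<^sup>2"
          by (intro power_mono add_left_mono norm_le_sum_cmod) simp
        finally have "?p x y ^ m \<le> ((1 + ?S)\<^sup>2) ^ m"
          using p[of x y] by (intro power_mono) auto
        then have "?p x y ^ m * ?T \<le> (1 + ?S) ^ (2 * m) * ?T"
          unfolding power_mult by (intro mult_right_mono) auto
        also note C[of x y]
        finally have "(?p x y ^ m * ?T)\<^sup>2 \<le> (C * exp (\<kappa> * (norm x)\<^sup>2))\<^sup>2"
          using p[of x y] by (intro power_mono) auto
        then have T: "?T\<^sup>2 \<le> C\<^sup>2 * exp (2 * \<kappa> * (norm x)\<^sup>2) / ?p x y ^ (2 * m)"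
        proof -
          have "0 < ?p x y ^ (2 * m)" using p[of x y] by (intro zero_less_power) linarith
          moreover have "exp (2 * \<kappa> * (norm x)\<^sup>2) = (exp (\<kappa> * (norm x)\<^sup>2))\<^sup>2"
            by (simp add: exp_double[symmetric] mult.assoc)
          moreover have "(?p x y ^ m * ?T)\<^sup>2 = ?T\<^sup>2 * ?p x y ^ (2 * m)"
            unfolding power_even_eq power_mult_distrib by (rule mult.commute)
          ultimately show ?thesis
            using \<open>(?p x y ^ m * ?T)\<^sup>2 \<le> _\<close>
            by (simp only: pos_le_divide_eq power_mult_distrib)
        qed
        have "cmod (F (cvec x y)) = C0 * exp (- (c / 2) * ((norm x)\<^sup>2 - (norm y)\<^sup>2)) * ?T"
          using C0 norm_exp_vec_sq[of "- (c / 2)" x y] by (simp add: f(2) H norm_mult)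
        then have "(cmod (F (cvec x y)))\<^sup>2 = C0\<^sup>2 * exp (- c * ((norm x)\<^sup>2 - (norm y)\<^sup>2)) * ?T\<^sup>2"
          by (simp add: power_mult_distrib exp_double[symmetric] algebra_simps)
        also have "\<dots> \<le> C0\<^sup>2 * exp (- c * ((norm x)\<^sup>2 - (norm y)\<^sup>2)) * (C\<^sup>2 * exp (2 * \<kappa> * (norm x)\<^sup>2) / ?p x y ^ (2 * m))"
          by (intro mult_left_mono T) auto
        also have "\<dots> = (C0 * C)\<^sup>2 * ((exp (- c * ((norm x)\<^sup>2 - (norm y)\<^sup>2)) * exp (2 * \<kappa> * (norm x)\<^sup>2)) / ?p x y ^ (2 * m))"
          by (simp add: power_mult_distrib)
        also have "exp (- c * ((norm x)\<^sup>2 - (norm y)\<^sup>2)) * exp (2 * \<kappa> * (norm x)\<^sup>2) = exp (- (1 / c) * (norm x)\<^sup>2 + c * (norm y)\<^sup>2)"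
          unfolding \<kappa> exp_add[symmetric] by (rule arg_cong[of _ _ exp]) (simp add: algebra_simps)
        finally show ?thesis .
      qed
      then show ?thesis by blast
    qed
    then show "\<exists>A. \<forall>m\<ge>1. \<forall>x y. (cmod (F (cvec x y)))\<^sup>2 \<le> A m * (exp (- (1 / c) * (norm x)\<^sup>2 + c * (norm y)\<^sup>2) / ?p x y ^ (2 * m))"
      by meson
  next
    assume "\<exists>A. \<forall>m\<ge>1. \<forall>x y. (cmod (F (cvec x y)))\<^sup>2 \<le> A m * (exp (- (1 / c) * (norm x)\<^sup>2 + c * (norm y)\<^sup>2) / ?p x y ^ (2 * m))"
    then obtain A where A: "\<And>m x y. 1 \<le> m \<Longrightarrow> (cmod (F (cvec x y)))\<^sup>2 \<le> A m * (exp (- (1 / c) * (norm x)\<^sup>2 + c * (norm y)\<^sup>2) / ?p x y ^ (2 * m))"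
      by blast
    define G where "G = (\<lambda>z. F z * exp (of_real (c / 2) * vec_sq z))"
    have GF: "exp (- (of_real c / 2) * vec_sq z) * G z = F z" for z
    proof -
      have "exp (- (of_real c / 2) * vec_sq z) * exp (of_real (c / 2) * vec_sq z) = 1"
        unfolding exp_add[symmetric] by simp
      then show ?thesis by (simp add: G_def mult.left_commute)
    qed
    \<comment> \<open>The class also requires m = 0, whereas the hypothesis starts at 1. Using
      \<open>Suc m\<close> covers all m, and the surplus powers of \<open>?p\<close>, which is at
      least 1, are dropped. The absolute value makes the square root meaningful whatever the sign of
      the constant.\<close>
    have G_bound: "cmod (G (cvec x y)) \<le> sqrt \<bar>A (Suc m)\<bar> * exp (\<kappa> * (norm x)\<^sup>2) / ?p x y ^ m" for m x y
    proof (rule power2_le_imp_le)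
      have "(cmod (G (cvec x y)))\<^sup>2 = (cmod (F (cvec x y)))\<^sup>2 * exp (c * ((norm x)\<^sup>2 - (norm y)\<^sup>2))"
        unfolding G_def norm_mult norm_exp_vec_sq by (simp add: power_mult_distrib exp_double[symmetric])
      also have "\<dots> \<le> A (Suc m) * (exp (- (1 / c) * (norm x)\<^sup>2 + c * (norm y)\<^sup>2) / ?p x y ^ (2 * Suc m)) * exp (c * ((norm x)\<^sup>2 - (norm y)\<^sup>2))"
        by (intro mult_right_mono A) auto
      also have "\<dots> = A (Suc m) * (exp (- (1 / c) * (norm x)\<^sup>2 + c * (norm y)\<^sup>2) * exp (c * ((norm x)\<^sup>2 - (norm y)\<^sup>2))) / ?p x y ^ (2 * Suc m)"
        by simp
      also have "exp (- (1 / c) * (norm x)\<^sup>2 + c * (norm y)\<^sup>2) * exp (c * ((norm x)\<^sup>2 - (norm y)\<^sup>2)) = exp (2 * \<kappa> * (norm x)\<^sup>2)"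
        unfolding \<kappa> exp_add[symmetric] by (rule arg_cong[of _ _ exp]) (simp add: algebra_simps)
      also have "A (Suc m) * exp (2 * \<kappa> * (norm x)\<^sup>2) / ?p x y ^ (2 * Suc m) \<le> \<bar>A (Suc m)\<bar> * exp (2 * \<kappa> * (norm x)\<^sup>2) / ?p x y ^ (2 * m)"
        using p[of x y] by (intro frac_le mult_right_mono power_increasing zero_less_power) (auto simp: add_pos_nonneg)
      also have "\<dots> = (sqrt \<bar>A (Suc m)\<bar> * exp (\<kappa> * (norm x)\<^sup>2) / ?p x y ^ m)\<^sup>2"
        by (simp add: power_mult_distrib power_divide exp_double[symmetric] power_even_eq mult.assoc)
      finally show "(cmod (G (cvec x y)))\<^sup>2 \<le> (sqrt \<bar>A (Suc m)\<bar> * exp (\<kappa> * (norm x)\<^sup>2) / ?p x y ^ m)\<^sup>2" .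
      show "0 \<le> sqrt \<bar>A (Suc m)\<bar> * exp (\<kappa> * (norm x)\<^sup>2) / ?p x y ^ m"
        using p[of x y] by simp
    qed
    have G: "G \<in> gauss_class \<kappa>"
      unfolding gauss_class_def
    proof (intro CollectI conjI)
      show "holomorphic_Cn G"
        unfolding G_def by (intro holomorphic_Cn_mult holomorphic_Cn_exp holomorphic_Cn_vec_sq assms(2))
    qed (use G_bound in blast)
    obtain K :: real where K: "0 < K" and inv: "gauss_transform c s (inverse_gauss c s G) z = of_real K * G z" for z
      using gauss_transform_inverse_gauss[OF s, where 'n = 'n] G unfolding \<kappa>_def by blast
    \<comment> \<open>C0 is the normalisation of the Mehler kernel and K the constant of Fourier
      inversion; both are positive.\<close>
    define f where "f = (\<lambda>u. of_real (1 / (C0 * K)) * inverse_gauss c s G u)"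
    have "f \<in> schwartz_space"
      unfolding f_def using G by (intro schwartz_space_scale inverse_gauss_schwartz s) (simp add: \<kappa>_def)
    moreover have "F = hermite_semigroup t f"
    proof
      fix z
      have "gauss_transform c s f z = of_real (1 / (C0 * K)) * gauss_transform c s (inverse_gauss c s G) z"
        unfolding gauss_transform_def f_def mult.assoc by (rule integral_mult_right_zero)
      also have "\<dots> = of_real (1 / C0) * G z"
        using K C0 by (simp add: inv)
      finally show "F z = hermite_semigroup t f z"
        using C0 GF[of z] by (simp add: H)
    qed
    ultimately show "\<exists>f \<in> schwartz_space. F = hermite_semigroup t f" by blast
  qed
qed

end
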